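(* Let $K$ be a field, let $A\subset K$ be a subring with $\mathrm{Frac}(A)=K$, let $\mathcal{U}$ be an infinite set, and let $\mathbf{R}^{\flat}$ be the ring of bounded elements of $K[[[x_i]]]_{i\in\mathcal{U}}$ (defined in the context). Suppose that either $K$ has characteristic $0$, or $K$ has characteristic $p>0$ and condition $(C_{\kappa})$ holds for $A$ with $\kappa=\#\mathcal{U}$. Then $\mathbf{R}^{\flat}$ is a polynomial $K$-algebra.
   Context: Graded means graded by the non-negative integers. For a ring $B$ and an infinite set $\mathcal{U}$, let $B[[[x_i]]]_{i\in\mathcal{U}}=\varprojlim B[x_i]_{i\in\mathcal{V}}$, the inverse limit in the category of graded rings over finite subsets $\mathcal{V}\subset\mathcal{U}$ of the standard-graded polynomial rings (transition maps set the extra variables to $0$). It is a graded ring whose degree $d$ elements are uniquely the formal sums $\sum c_e x^e$ over multi-indices $e\colon\mathcal{U}\to\mathbf{N}$ of finite support and degree $d$ (degree = sum of values), with arbitrary $c_e\in B$. Put $\mathbf{R}=K[[[x_i]]]_{i\in\mathcal{U}}$. A subset $S\subset K$ is bounded if there is a non-zero $b\in A$ with $S\subset b^{-1}A$. $\mathbf{R}^{\flat}\subset\mathbf{R}$ is the subring of elements whose set of coefficients is bounded; it is naturally identified with $K\otimes_A A[[[x_i]]]_{i\in\mathcal{U}}$. When $K$ has characteristic $p$ and $\kappa$ is a cardinal, condition $(C_\kappa)$ on $A$ is: given $\epsilon_1,\ldots,\epsilon_s\in K$ and a subset $S$ of $A\cap\sum_{j=1}^s\epsilon_jK^p$ of cardinality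 at most $\kappa$, there exists a non-zero $b\in A$ such that $S\subset b^{-p}\sum_{j=1}^s\epsilon_jA^p$. Here $K^p=\{x^p: x\in K\}$ and $A^p=\{a^p: a\in A\}$. A graded $K$-algebra $R$ with $R_0=K$ is a polynomial $K$-algebra if there is a (possibly infinite) set of homogeneous elements of positive degree that is algebraically independent over $K$ and generates $R$ as a $K$-algebra. *)

theory Defs
  imports "HOL-Computational_Algebra.Computational_Algebra" "HOL-Library.Poly_Mapping"
begin

unbundle cardinal_syntax

text \<open>
  A multi-index is a finitely supported function \<open>e :: 'u \<Rightarrow>\<^sub>0 nat\<close>; it stands for the
  monomial \<open>x\<^sup>e\<close>.
\<close>

definition mdeg :: "('u \<Rightarrow>\<^sub>0 nat) \<Rightarrow> nat" where
  "mdeg e = (\<Sum>i\<in>Poly_Mapping.keys e. Poly_Mapping.lookup e i)"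

lemma mdeg_superset:
  assumes "finite S" "Poly_Mapping.keys e \<subseteq> S"
  shows "mdeg e = (\<Sum>i\<in>S. Poly_Mapping.lookup e i)"
  unfolding mdeg_def using assms
  by (intro sum.mono_neutral_left) (auto simp: in_keys_iff)

lemma mdeg_0 [simp]: "mdeg 0 = 0"
  by (simp add: mdeg_def)

lemma mdeg_add: "mdeg (a + b) = mdeg a + mdeg b"
proof -
  let ?S = "Poly_Mapping.keys a \<union> Poly_Mapping.keys b"
  have "Poly_Mapping.keys (a + b) \<subseteq> ?S"
    by (rule Poly_Mapping.keys_add)
  then show ?thesis
    by (simp add: mdeg_superset[of ?S] lookup_add sum.distrib)
qed

lemma mdeg_eq_0_iff: "mdeg e = 0 \<longleftrightarrow> e = 0"
  by (auto simp: mdeg_def in_keys_iff intro!: poly_mapping_eqI)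

lemma keys_add_nat:
  fixes a b :: "'u \<Rightarrow>\<^sub>0 nat"
  shows "Poly_Mapping.keys (a + b) = Poly_Mapping.keys a \<union> Poly_Mapping.keys b"
  by (auto simp: in_keys_iff lookup_add)

lemma finite_decompositions: "finite {(a, b). a + b = (e :: 'u \<Rightarrow>\<^sub>0 nat)}"
proof -
  let ?D = "{(a, b). a + b = e}"
  let ?P = "PiE (Poly_Mapping.keys e) (\<lambda>i. {..Poly_Mapping.lookup e i})"
  let ?r = "\<lambda>a. restrict (Poly_Mapping.lookup a) (Poly_Mapping.keys e)"
  have le: "Poly_Mapping.lookup a i \<le> Poly_Mapping.lookup e i" if "a + b = e" for a b i
    using that by (auto simp: lookup_add)
  have "inj_on ?r (fst ` ?D)"
  proof (rule inj_onI)
    fix a a' assume A: "a \<in> fst ` ?D" "a' \<in> fst ` ?D" and eq: "?r a = ?r a'"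
    show "a = a'"
    proof (rule poly_mapping_eqI)
      fix i
      show "Poly_Mapping.lookup a i = Poly_Mapping.lookup a' i"
      proof (cases "i \<in> Poly_Mapping.keys e")
        case True
        then show ?thesis using fun_cong[OF eq, of i] by simp
      next
        case False
        then have "Poly_Mapping.lookup e i = 0" by (simp add: in_keys_iff)
        then show ?thesis using A le[of a _ i] le[of a' _ i] by force
      qed
    qed
  qed
  moreover have "?r ` fst ` ?D \<subseteq> ?P"
    using le by fastforce
  moreover have "finite ?P"
    by (intro finite_PiE) auto
  ultimately have "finite (fst ` ?D)"
    by (meson finite_imageD finite_subset)
  moreover have "inj_on fst ?D"
    by (auto simp: inj_on_def)
  ultimately show ?thesis
    using finite_imageD by blast
qed

text \<open>
  The graded inverse limit of polynomial rings, taken over all finite sets of variables from the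
  type \<open>'u\<close>. Its degree \<open>d\<close> part consists of arbitrary formal sums of monomials of degree \<open>d\<close>;
  since it is the direct sum of these parts, an element is a coefficient function
  whose support has bounded degree.
\<close>

typedef (overloaded) ('u, 'k) gseries =
  "{f :: ('u \<Rightarrow>\<^sub>0 nat) \<Rightarrow> 'k::zero. \<exists>d. \<forall>e. f e \<noteq> 0 \<longrightarrow> mdeg e \<le> d}"
  morphisms gs_coeff Abs_gseries
  by (rule exI[of _ "\<lambda>_. 0"]) simp

setup_lifting type_definition_gseries

lemma gseries_eqI: "(\<And>e. gs_coeff f e = gs_coeff g e) \<Longrightarrow> f = g"
  by (simp add: gs_coeff_inject[symmetric] fun_eq_iff)

instantiation gseries :: (type, comm_ring_1) comm_ring_1
begin

lift_definition zero_gseries :: "('a, 'b) gseries" is "\<lambda>_. 0"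
  by simp

lift_definition one_gseries :: "('a, 'b) gseries" is "\<lambda>e. if e = 0 then 1 else 0"
  by auto

lift_definition plus_gseries :: "('a, 'b) gseries \<Rightarrow> ('a, 'b) gseries \<Rightarrow> ('a, 'b) gseries"
  is "\<lambda>f g e. f e + g e"
proof -
  fix f g :: "('a \<Rightarrow>\<^sub>0 nat) \<Rightarrow> 'b"
  assume "\<exists>d. \<forall>e. f e \<noteq> 0 \<longrightarrow> mdeg e \<le> d" "\<exists>d. \<forall>e. g e \<noteq> 0 \<longrightarrow> mdeg e \<le> d"
  then obtain d d' where "\<And>e. f e \<noteq> 0 \<Longrightarrow> mdeg e \<le> d" "\<And>e. g e \<noteq> 0 \<Longrightarrow> mdeg e \<le> d'"
    by blast
  then have "f e + g e \<noteq> 0 \<longrightarrow> mdeg e \<le> max d d'" for e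
    by (metis add_0 max.coboundedI1 max.coboundedI2)
  then show "\<exists>d. \<forall>e. f e + g e \<noteq> 0 \<longrightarrow> mdeg e \<le> d"
    by blast
qed

lift_definition uminus_gseries :: "('a, 'b) gseries \<Rightarrow> ('a, 'b) gseries" is "\<lambda>f e. - f e"
  by simp

definition minus_gseries :: "('a, 'b) gseries \<Rightarrow> ('a, 'b) gseries \<Rightarrow> ('a, 'b) gseries" where
  "minus_gseries f g = f + - g"

lift_definition times_gseries :: "('a, 'b) gseries \<Rightarrow> ('a, 'b) gseries \<Rightarrow> ('a, 'b) gseries"
  is "\<lambda>f g e. \<Sum>(a, b)\<in>{(a, b). a + b = e}. f a * g b"
proof -
  fix f g :: "('a \<Rightarrow>\<^sub>0 nat) \<Rightarrow> 'b"
  assume "\<exists>d. \<forall>e. f e \<noteq> 0 \<longrightarrow> mdeg e \<le> d" "\<exists>d. \<forall>e. g e \<noteq> 0 \<longrightarrow> mdeg e \<le> d"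
  then obtain d d' where *: "\<And>e. f e \<noteq> 0 \<Longrightarrow> mdeg e \<le> d" "\<And>e. g e \<noteq> 0 \<Longrightarrow> mdeg e \<le> d'"
    by blast
  have "mdeg e \<le> d + d'" if "(\<Sum>(a, b)\<in>{(a, b). a + b = e}. f a * g b) \<noteq> 0" for e
  proof -
    from that obtain a b where "a + b = e" "f a * g b \<noteq> 0"
      by (auto elim!: sum.not_neutral_contains_not_neutral)
    then have "mdeg e = mdeg a + mdeg b" "f a \<noteq> 0" "g b \<noteq> 0"
      by (auto simp: mdeg_add[symmetric])
    then show ?thesis using * by (simp add: add_mono)
  qed
  then show "\<exists>d. \<forall>e. (\<Sum>(a, b)\<in>{(a, b). a + b = e}. f a * g b) \<noteq> 0 \<longrightarrow> mdeg e \<le> d"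
    by blast
qed

instance
proof
  fix f g h :: "('a, 'b) gseries"
  show "f * g * h = f * (g * h)"
  proof (rule gseries_eqI)
    fix e
    let ?D = "\<lambda>e :: 'a \<Rightarrow>\<^sub>0 nat. {(a, b). a + b = e}"
    have "gs_coeff (f * g * h) e =
        (\<Sum>x\<in>?D e. \<Sum>y\<in>?D (fst x). gs_coeff f (fst y) * gs_coeff g (snd y) * gs_coeff h (snd x))"
      by (simp add: times_gseries.rep_eq sum_distrib_right case_prod_unfold)
    also have "\<dots> = (\<Sum>(x, y)\<in>(SIGMA x:?D e. ?D (fst x)).
        gs_coeff f (fst y) * gs_coeff g (snd y) * gs_coeff h (snd x))"
      by (rule sum.Sigma) (auto simp: finite_decompositions)
    also have "\<dots> = (\<Sum>(x, y)\<in>(SIGMA x:?D e. ?D (snd x)).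
        gs_coeff f (fst x) * (gs_coeff g (fst y) * gs_coeff h (snd y)))"
      by (rule sum.reindex_bij_witness[of _
            "\<lambda>((a, bc), (b, c)). ((a + b, c), (a, b))"
            "\<lambda>((ab, c), (a, b)). ((a, b + c), (b, c))"])
         (auto simp: add.assoc mult.assoc)
    also have "\<dots> = (\<Sum>x\<in>?D e. \<Sum>y\<in>?D (snd x).
        gs_coeff f (fst x) * (gs_coeff g (fst y) * gs_coeff h (snd y)))"
      by (rule sum.Sigma[symmetric]) (auto simp: finite_decompositions)
    also have "\<dots> = gs_coeff (f * (g * h)) e"
      by (simp add: times_gseries.rep_eq sum_distrib_left case_prod_unfold)
    finally show "gs_coeff (f * g * h) e = gs_coeff (f * (g * h)) e" .
  qed
  show "f * g = g * f"
  proof (rule gseries_eqI)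
    fix e
    show "gs_coeff (f * g) e = gs_coeff (g * f) e"
      unfolding times_gseries.rep_eq
      by (rule sum.reindex_bij_witness[of _ "\<lambda>(a, b). (b, a)" "\<lambda>(a, b). (b, a)"])
         (auto simp: add.commute mult.commute)
  qed
  show "1 * f = f"
  proof (rule gseries_eqI)
    fix e
    have "gs_coeff (1 * f) e = (\<Sum>x\<in>{(a, b). a + b = e}. if x = (0, e) then gs_coeff f e else 0)"
      unfolding times_gseries.rep_eq one_gseries.rep_eq
      by (rule sum.cong) (auto split: if_splits)
    also have "\<dots> = gs_coeff f e"
      by (simp add: finite_decompositions)
    finally show "gs_coeff (1 * f) e = gs_coeff f e" .
  qed
  show "(f + g) * h = f * h + g * h"
    by (rule gseries_eqI)
       (simp add: times_gseries.rep_eq plus_gseries.rep_eq case_prod_unfold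
         sum.distrib[symmetric] distrib_right)
  show "f + g + h = f + (g + h)" "f + g = g + f" "0 + f = f"
    by (rule gseries_eqI; simp add: plus_gseries.rep_eq zero_gseries.rep_eq add_ac)+
  show "- f + f = 0"
    by (rule gseries_eqI) (simp add: plus_gseries.rep_eq zero_gseries.rep_eq uminus_gseries.rep_eq)
  show "f - g = f + - g"
    by (rule minus_gseries_def)
  have "gs_coeff (0 :: ('a, 'b) gseries) 0 \<noteq> gs_coeff 1 0"
    by (simp add: zero_gseries.rep_eq one_gseries.rep_eq)
  then show "(0 :: ('a, 'b) gseries) \<noteq> 1"
    by metis
qed

end

lift_definition const_gseries :: "'k::zero \<Rightarrow> ('u, 'k) gseries"
  is "\<lambda>c e. if e = 0 then c else 0"
  by auto

definition gseries_over :: "'u set \<Rightarrow> ('u, 'k::zero) gseries set" where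
  "gseries_over U = {f. \<forall>e. gs_coeff f e \<noteq> 0 \<longrightarrow> Poly_Mapping.keys e \<subseteq> U}"

definition homogeneous :: "nat \<Rightarrow> ('u, 'k::zero) gseries set" where
  "homogeneous d = {f. \<forall>e. gs_coeff f e \<noteq> 0 \<longrightarrow> mdeg e = d}"

definition is_subring :: "'a::comm_ring_1 set \<Rightarrow> bool" where
  "is_subring A \<longleftrightarrow> 0 \<in> A \<and> 1 \<in> A \<and>
     (\<forall>a\<in>A. \<forall>b\<in>A. a + b \<in> A \<and> a * b \<in> A) \<and> (\<forall>a\<in>A. - a \<in> A)"

definition is_fraction_field_of :: "'k::field set \<Rightarrow> bool" where
  "is_fraction_field_of A \<longleftrightarrow> (\<forall>x. \<exists>a\<in>A. \<exists>b\<in>A. b \<noteq> 0 \<and> x = a / b)"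

definition bounded_wrt :: "'k::field set \<Rightarrow> 'k set \<Rightarrow> bool" where
  "bounded_wrt A S \<longleftrightarrow> (\<exists>b\<in>A. b \<noteq> 0 \<and> S \<subseteq> (\<lambda>a. inverse b * a) ` A)"

text \<open>
  The monomials in variables outside \<open>U\<close> only contribute the coefficient \<open>0\<close>, which does not
  affect boundedness.
\<close>

definition gseries_flat :: "'k::field set \<Rightarrow> 'u set \<Rightarrow> ('u, 'k) gseries set" where
  "gseries_flat A U = {f \<in> gseries_over U. bounded_wrt A (range (gs_coeff f))}"

text \<open>
  The condition \<open>(C\<^sub>\<kappa>)\<close>. In \<open>eps_span p s \<epsilon> B\<close>, which is \<open>\<epsilon>\<^sub>1 B\<^sup>p + \<dots> + \<epsilon>\<^sub>s B\<^sup>p\<close>, the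
  exponent denotes the set of \<open>p\<close>-th powers, not products of \<open>p\<close> elements. The cardinal
  \<open>\<kappa>\<close> is represented, as in the cardinal library, by a well-order.
\<close>

definition eps_span :: "nat \<Rightarrow> nat \<Rightarrow> (nat \<Rightarrow> 'k::field) \<Rightarrow> 'k set \<Rightarrow> 'k set" where
  "eps_span p s \<epsilon> B = {\<Sum>j=1..s. \<epsilon> j * y j ^ p | y. \<forall>j\<in>{1..s}. y j \<in> B}"

definition cond_C :: "nat \<Rightarrow> 'c rel \<Rightarrow> 'k::field set \<Rightarrow> bool" where
  "cond_C p \<kappa> A \<longleftrightarrow>
     (\<forall>s \<epsilon> S. S \<subseteq> A \<inter> eps_span p s \<epsilon> UNIV \<and> |S| \<le>o \<kappa> \<longrightarrow>
        (\<exists>b\<in>A. b \<noteq> 0 \<and> S \<subseteq> (\<lambda>z. inverse (b ^ p) * z) ` eps_span p s \<epsilon> A))"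

text \<open>
  Below, \<open>\<iota>\<close> is the structure map of a \<open>K\<close>-algebra, \<open>R\<close> is a \<open>K\<close>-subalgebra of an ambient
  commutative ring, and \<open>Rd d\<close> is the degree \<open>d\<close> part of \<open>R\<close>.
\<close>

definition graded_algebra ::
  "('k::field \<Rightarrow> 'r::comm_ring_1) \<Rightarrow> 'r set \<Rightarrow> (nat \<Rightarrow> 'r set) \<Rightarrow> bool" where
  "graded_algebra \<iota> R Rd \<longleftrightarrow>
     \<iota> 1 = 1 \<and> (\<forall>a b. \<iota> (a + b) = \<iota> a + \<iota> b \<and> \<iota> (a * b) = \<iota> a * \<iota> b) \<and>
     is_subring R \<and> range \<iota> \<subseteq> R \<and>
     (\<forall>d. Rd d \<subseteq> R \<and> 0 \<in> Rd d \<and> (\<forall>f\<in>Rd d. \<forall>g\<in>Rd d. f + g \<in> Rd d) \<and>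
        (\<forall>c. \<forall>f\<in>Rd d. \<iota> c * f \<in> Rd d)) \<and>
     (\<forall>d d'. \<forall>f\<in>Rd d. \<forall>g\<in>Rd d'. f * g \<in> Rd (d + d')) \<and>
     (\<forall>f\<in>R. \<exists>!h. (\<forall>d. h d \<in> Rd d) \<and> finite {d. h d \<noteq> 0} \<and> f = (\<Sum>d\<in>{d. h d \<noteq> 0}. h d))"

lemma bounded_wrt_iff: "bounded_wrt A S \<longleftrightarrow> (\<exists>b\<in>A. b \<noteq> 0 \<and> (\<forall>x\<in>S. b * x \<in> A))"
proof -
  have "x \<in> (\<lambda>a. inverse b * a) ` A \<longleftrightarrow> b * x \<in> A" if "b \<noteq> 0" for b x :: 'a
    using that by (auto simp: image_iff field_simps intro!: bexI[of _ "b * x"])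
  then show ?thesis
    unfolding bounded_wrt_def by blast
qed

lemma is_subring_sum:
  assumes "is_subring A" "\<And>i. i \<in> I \<Longrightarrow> f i \<in> A"
  shows "sum f I \<in> A"
  using assms by (induction I rule: infinite_finite_induct) (auto simp: is_subring_def)

lemma gs_coeff_const_mult: "gs_coeff (const_gseries c * f) e = c * gs_coeff f e"
proof -
  have "gs_coeff (const_gseries c * f) e =
      (\<Sum>x\<in>{(a, b). a + b = e}. if x = (0, e) then c * gs_coeff f e else 0)"
    unfolding times_gseries.rep_eq const_gseries.rep_eq
    by (rule sum.cong) (auto split: if_splits)
  then show ?thesis
    by (simp add: finite_decompositions)
qed

lemma gs_coeff_sum: "gs_coeff (\<Sum>i\<in>I. f i) e = (\<Sum>i\<in>I. gs_coeff (f i) e)"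
  by (induction I rule: infinite_finite_induct)
     (auto simp: zero_gseries.rep_eq plus_gseries.rep_eq)

lemma is_subring_gseries_flat:
  assumes A: "is_subring A"
  shows "is_subring (gseries_flat A U)"
proof -
  have cl: "0 \<in> A" "1 \<in> A" "\<And>a b. a \<in> A \<Longrightarrow> b \<in> A \<Longrightarrow> a + b \<in> A"
    "\<And>a b. a \<in> A \<Longrightarrow> b \<in> A \<Longrightarrow> a * b \<in> A" "\<And>a. a \<in> A \<Longrightarrow> - a \<in> A"
    using A by (auto simp: is_subring_def)
  have "f + g \<in> gseries_flat A U \<and> f * g \<in> gseries_flat A U"
    if f: "f \<in> gseries_flat A U" and g: "g \<in> gseries_flat A U" for f g
  proof -
    obtain b where b: "b \<in> A" "b \<noteq> 0" "\<And>e. b * gs_coeff f e \<in> A"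
      using f by (auto simp: gseries_flat_def bounded_wrt_iff)
    obtain c where c: "c \<in> A" "c \<noteq> 0" "\<And>e. c * gs_coeff g e \<in> A"
      using g by (auto simp: gseries_flat_def bounded_wrt_iff)
    have "b * c * gs_coeff (f + g) e \<in> A" for e
    proof -
      have "b * c * gs_coeff (f + g) e = c * (b * gs_coeff f e) + b * (c * gs_coeff g e)"
        by (simp add: plus_gseries.rep_eq algebra_simps)
      then show ?thesis using b c cl by simp
    qed
    moreover have "b * c * gs_coeff (f * g) e \<in> A" for e
    proof -
      have "b * c * gs_coeff (f * g) e =
          (\<Sum>(u, v)\<in>{(u, v). u + v = e}. (b * gs_coeff f u) * (c * gs_coeff g v))"
        by (simp add: times_gseries.rep_eq sum_distrib_left case_prod_unfold algebra_simps)
      also have "\<dots> \<in> A"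
        by (rule is_subring_sum[OF A]) (auto intro!: cl b c)
      finally show ?thesis .
    qed
    ultimately have "bounded_wrt A (range (gs_coeff (f + g)))"
      "bounded_wrt A (range (gs_coeff (f * g)))"
      using b c cl by (auto simp: bounded_wrt_iff intro!: bexI[of _ "b * c"])
    moreover have "f + g \<in> gseries_over U"
      using f g by (force simp: gseries_flat_def gseries_over_def plus_gseries.rep_eq)
    moreover have "f * g \<in> gseries_over U"
      unfolding gseries_over_def
    proof (intro CollectI allI impI)
      fix e assume "gs_coeff (f * g) e \<noteq> 0"
      then obtain u v where uv: "u + v = e" "gs_coeff f u * gs_coeff g v \<noteq> 0"
        unfolding times_gseries.rep_eq by (auto elim!: sum.not_neutral_contains_not_neutral)
      then have "Poly_Mapping.keys u \<subseteq> U" "Poly_Mapping.keys v \<subseteq> U"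
        using f g by (auto simp: gseries_flat_def gseries_over_def)
      then show "Poly_Mapping.keys e \<subseteq> U"
        using uv by (auto simp: keys_add_nat simp flip: uv(1))
    qed
    ultimately show ?thesis
      by (auto simp: gseries_flat_def)
  qed
  moreover have "- f \<in> gseries_flat A U" if "f \<in> gseries_flat A U" for f
    using that cl by (auto simp: gseries_flat_def gseries_over_def bounded_wrt_iff
        uminus_gseries.rep_eq)
  moreover have "0 \<in> gseries_flat A U" "1 \<in> gseries_flat A U"
    using cl by (auto simp: gseries_flat_def gseries_over_def bounded_wrt_iff
        zero_gseries.rep_eq one_gseries.rep_eq intro!: bexI[of _ 1])
  ultimately show ?thesis
    by (auto simp: is_subring_def)
qed

lemma homogeneous_mult:
  fixes f g :: "('u, 'k::comm_ring_1) gseries"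
  assumes "f \<in> homogeneous d" "g \<in> homogeneous d'"
  shows "f * g \<in> homogeneous (d + d')"
  unfolding homogeneous_def
proof (intro CollectI allI impI)
  fix e assume "gs_coeff (f * g) e \<noteq> 0"
  then obtain u v where uv: "u + v = e" "gs_coeff f u * gs_coeff g v \<noteq> 0"
    unfolding times_gseries.rep_eq by (auto elim!: sum.not_neutral_contains_not_neutral)
  then have "gs_coeff f u \<noteq> 0" "gs_coeff g v \<noteq> 0"
    by auto
  with assms have "mdeg u = d" "mdeg v = d'"
    by (auto simp: homogeneous_def)
  then show "mdeg e = d + d'"
    using mdeg_add uv(1) by blast
qed

lift_definition hom_part :: "nat \<Rightarrow> ('u, 'k::zero) gseries \<Rightarrow> ('u, 'k) gseries"
  is "\<lambda>d f e. if mdeg e = d then f e else 0"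
  by auto

lemma const_gseries_in_flat:
  assumes A: "is_subring A" and K: "is_fraction_field_of A"
  shows "const_gseries c \<in> gseries_flat A U"
proof -
  obtain a b where ab: "a \<in> A" "b \<in> A" "b \<noteq> 0" "c = a / b"
    using K unfolding is_fraction_field_of_def by blast
  have "0 \<in> A"
    using A by (simp add: is_subring_def)
  then have "bounded_wrt A (range (gs_coeff (const_gseries c :: ('u, 'a) gseries)))"
    using ab by (auto simp: bounded_wrt_iff const_gseries.rep_eq intro!: bexI[of _ b])
  then show ?thesis
    by (auto simp: gseries_flat_def gseries_over_def const_gseries.rep_eq)
qed

lemma gseries_flat_degree_0:
  assumes "is_subring A" "is_fraction_field_of A"
  shows "gseries_flat A U \<inter> homogeneous 0 = range const_gseries"
proof (intro equalityI subsetI)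
  fix f assume "f \<in> gseries_flat A U \<inter> homogeneous 0"
  then have "f = const_gseries (gs_coeff f 0)"
    by (intro gseries_eqI) (auto simp: const_gseries.rep_eq homogeneous_def mdeg_eq_0_iff)
  then show "f \<in> range const_gseries"
    by blast
next
  fix f assume "f \<in> range (const_gseries :: 'a \<Rightarrow> ('b, 'a) gseries)"
  then show "f \<in> gseries_flat A U \<inter> homogeneous 0"
    using const_gseries_in_flat[OF assms] by (auto simp: homogeneous_def const_gseries.rep_eq split: if_splits)
qed

lemma graded_algebra_gseries_flat:
  assumes A: "is_subring A" and K: "is_fraction_field_of A"
  shows "graded_algebra const_gseries (gseries_flat A U)
           (\<lambda>d. gseries_flat A U \<inter> homogeneous d)"
proof -
  note sub = is_subring_gseries_flat[OF A, of U]
  note const = const_gseries_in_flat[OF A K]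
  let ?Rd = "\<lambda>d. gseries_flat A U \<inter> homogeneous d"
  have hom: "const_gseries 1 = (1 :: ('b, 'a) gseries)"
    "const_gseries (a + b) = (const_gseries a + const_gseries b :: ('b, 'a) gseries)"
    "const_gseries (a * b) = (const_gseries a * const_gseries b :: ('b, 'a) gseries)" for a b
    by (rule gseries_eqI;
        simp add: gs_coeff_const_mult const_gseries.rep_eq one_gseries.rep_eq plus_gseries.rep_eq)+
  have direct: "\<exists>!h. (\<forall>d. h d \<in> ?Rd d) \<and> finite {d. h d \<noteq> 0} \<and> f = (\<Sum>d\<in>{d. h d \<noteq> 0}. h d)"
    if f: "f \<in> gseries_flat A U" for f
  proof -
    have mem: "hom_part d f \<in> ?Rd d" for d
    proof -
      have "0 \<in> A" using A by (simp add: is_subring_def)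
      then show ?thesis
        using f by (auto simp: gseries_flat_def gseries_over_def homogeneous_def bounded_wrt_iff
            hom_part.rep_eq)
    qed
    obtain n where n: "\<And>e. gs_coeff f e \<noteq> 0 \<Longrightarrow> mdeg e \<le> n"
      using gs_coeff[of f] by auto
    have "hom_part d f = 0" if "d > n" for d
      using n that by (intro gseries_eqI) (force simp: hom_part.rep_eq zero_gseries.rep_eq)
    then have "{d. hom_part d f \<noteq> 0} \<subseteq> {..n}"
      by (auto simp flip: not_less)
    then have fin: "finite {d. hom_part d f \<noteq> 0}"
      by (rule finite_subset) simp
    have coeff_sum: "gs_coeff (\<Sum>d\<in>{d. h d \<noteq> 0}. h d) e = gs_coeff (h (mdeg e)) e"
      if "\<And>d. h d \<in> homogeneous d" "finite {d. h d \<noteq> 0}" for h and e :: "'b \<Rightarrow>\<^sub>0 nat"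
    proof -
      have "gs_coeff (\<Sum>d\<in>{d. h d \<noteq> 0}. h d) e =
          (\<Sum>d\<in>{d. h d \<noteq> 0}. if d = mdeg e then gs_coeff (h d) e else 0)"
        unfolding gs_coeff_sum using that(1)
        by (intro sum.cong) (auto simp: homogeneous_def)
      also have "\<dots> = gs_coeff (h (mdeg e)) e"
        using that(2) by (auto simp: zero_gseries.rep_eq)
      finally show ?thesis .
    qed
    show ?thesis
    proof (rule ex1I[of _ "\<lambda>d. hom_part d f"], intro conjI allI)
      show "f = (\<Sum>d\<in>{d. hom_part d f \<noteq> 0}. hom_part d f)"
        using coeff_sum[of "\<lambda>d. hom_part d f"] mem fin
        by (intro gseries_eqI) (auto simp: hom_part.rep_eq)
    next
      fix h assume h: "(\<forall>d. h d \<in> ?Rd d) \<and> finite {d. h d \<noteq> 0} \<and> f = (\<Sum>d\<in>{d. h d \<noteq> 0}. h d)"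
      show "h = (\<lambda>d. hom_part d f)"
      proof (rule ext, rule gseries_eqI)
        fix d e
        have "gs_coeff f e = gs_coeff (h (mdeg e)) e"
          using h coeff_sum[of h e] by auto
        moreover have "gs_coeff (h d) e = 0" if "mdeg e \<noteq> d"
          using h that by (auto simp: homogeneous_def)
        ultimately show "gs_coeff (h d) e = gs_coeff (hom_part d f) e"
          by (auto simp: hom_part.rep_eq)
      qed
    qed (use mem fin in auto)
  qed
  have "0 \<in> homogeneous d" "f \<in> homogeneous d \<Longrightarrow> g \<in> homogeneous d \<Longrightarrow> f + g \<in> homogeneous d"
    "f \<in> homogeneous d \<Longrightarrow> const_gseries c * f \<in> homogeneous d"
    for d c and f g :: "('b, 'a) gseries"
    by (force simp: homogeneous_def zero_gseries.rep_eq plus_gseries.rep_eq gs_coeff_const_mult)+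
  moreover have "range const_gseries \<subseteq> gseries_flat A U"
    using const by blast
  moreover have "const_gseries c * f \<in> gseries_flat A U" if "f \<in> gseries_flat A U" for c f
    using const sub that by (auto simp: is_subring_def)
  ultimately show ?thesis
    unfolding graded_algebra_def
    using hom sub direct const
    by (intro conjI allI ballI) (auto simp: is_subring_def homogeneous_mult)
qed

text \<open>
  Polynomials over \<open>K\<close> in variables indexed by a type \<open>'x\<close> are the elements of
  \<open>('x \<Rightarrow>\<^sub>0 nat) \<Rightarrow>\<^sub>0 'k\<close>. Here the index type is the ring itself: a subset \<open>X\<close> of it is
  a family of variables indexed by itself, and the variable with index \<open>x\<close> is evaluated at \<open>x\<close>.
\<close>

definition polys_in :: "'x set \<Rightarrow> (('x \<Rightarrow>\<^sub>0 nat) \<Rightarrow>\<^sub>0 'k::zero) set" where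
  "polys_in X = {P. \<forall>m\<in>Poly_Mapping.keys P. Poly_Mapping.keys m \<subseteq> X}"

definition poly_eval ::
  "('k::field \<Rightarrow> 'r::comm_ring_1) \<Rightarrow> (('r \<Rightarrow>\<^sub>0 nat) \<Rightarrow>\<^sub>0 'k) \<Rightarrow> 'r" where
  "poly_eval \<iota> P = (\<Sum>m\<in>Poly_Mapping.keys P.
     \<iota> (Poly_Mapping.lookup P m) * (\<Prod>x\<in>Poly_Mapping.keys m. x ^ Poly_Mapping.lookup m x))"

definition algebraically_independent :: "('k::field \<Rightarrow> 'r::comm_ring_1) \<Rightarrow> 'r set \<Rightarrow> bool" where
  "algebraically_independent \<iota> X \<longleftrightarrow> (\<forall>P\<in>polys_in X. poly_eval \<iota> P = 0 \<longrightarrow> P = 0)"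

definition is_polynomial_algebra ::
  "('k::field \<Rightarrow> 'r::comm_ring_1) \<Rightarrow> 'r set \<Rightarrow> (nat \<Rightarrow> 'r set) \<Rightarrow> bool" where
  "is_polynomial_algebra \<iota> R Rd \<longleftrightarrow>
     graded_algebra \<iota> R Rd \<and> Rd 0 = range \<iota> \<and>
     (\<exists>X. X \<subseteq> (\<Union>d\<in>{0<..}. Rd d) \<and> algebraically_independent \<iota> X \<and>
          R = poly_eval \<iota> ` polys_in X)"

end

theory Submission
  imports Defs
begin

text \<open>
  Let \<open>R\<close> be the ring of bounded elements. The generators are the obvious candidates: a set \<open>X\<close> of
  homogeneous elements of positive degree whose classes form a \<open>K\<close>-basis of \<open>R\<^sub>+ / R\<^sub>+\<^sup>2\<close>, where \<open>R\<^sub>+\<close>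
  consists of the elements without constant term. Such an \<open>X\<close> generates \<open>R\<close> by induction on the degree, so all
  the work is to show that the monomials in \<open>X\<close> are linearly independent over \<open>K\<close>.

  The tool is the family of Hasse derivatives \<open>\<partial>\<^sub>i\<^sup>(\<^sup>k\<^sup>)\<close>, in which a monomial with exponent \<open>n\<close> at
  \<open>x\<^sub>i\<close> is multiplied by the binomial coefficient of \<open>n\<close> and \<open>k\<close> and its exponent drops to \<open>n - k\<close>.
  They act on \<open>R\<close> because binomial coefficients are
  integers, they lower the degree, they satisfy the Leibniz rule, and an element killed by all of
  them with \<open>k > 0\<close> is constant. The last property holds in every characteristic; ordinary partial
  derivatives only have it in characteristic \<open>0\<close>.

  The central statement is \<open>powers_independent_over_hasse_stable\<close>. Let \<open>B\<close> be a \<open>K\<close>-subalgebra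
  stable under all Hasse derivatives and let \<open>y\<close> lie outside \<open>B\<close>, while all proper Hasse
  derivatives of \<open>y\<close> lie in \<open>B\<close>. Then \<open>1, y, y\<^sup>2, \<dots>\<close> are linearly independent over \<open>B\<close>, as far as
  the exponents stay below the characteristic \<open>p\<close> when \<open>p > 0\<close>. Indeed, in a relation
  \<open>d\<^sub>e y\<^sup>e + d\<^sub>e\<^sub>-\<^sub>1 y\<^sup>e\<^sup>-\<^sup>1 + \<dots> = 0\<close> with \<open>d\<^sub>e\<close> of minimal degree, a Hasse derivative yields a
  relation whose leading coefficient is the derivative of \<open>d\<^sub>e\<close>, of smaller degree, hence \<open>0\<close>. So
  \<open>d\<^sub>e\<close> is a constant, the derived relations have lower order in \<open>y\<close> and are trivial by
  induction, and their leading coefficients are the derivatives of \<open>d\<^sub>e\<^sub>-\<^sub>1 + e d\<^sub>e y\<close>, which is therefore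
  constant as well. Since \<open>e\<close> is invertible in \<open>K\<close>, this puts \<open>y\<close> into \<open>B\<close> unless \<open>d\<^sub>e = 0\<close>.

  Order \<open>X\<close> by degree. For \<open>y\<close> in \<open>X\<close>, take for \<open>B\<close> the algebra generated by
  the elements of \<open>X\<close> of smaller degree, some further elements of \<open>X\<close> of the same degree as \<open>y\<close>, and all
  \<open>p\<close>-th powers of elements of \<open>X\<close> (in characteristic \<open>0\<close> the latter contribute
  \<open>x\<^sup>0 = 1\<close> only). It is stable, and it does not contain \<open>y\<close> because \<open>X\<close> is a basis modulo
  decomposable elements and \<open>p\<close>-th powers are decomposable. Adding the elements of \<open>X\<close> one by one
  shows that the monomials with exponents below \<open>p\<close> are independent over the algebra generated by
  the \<open>p\<close>-th powers (\<open>reduced_monomials_independent\<close>). In characteristic \<open>0\<close> this is the claim.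
  In characteristic \<open>p\<close> it reduces a \<open>K\<close>-linear relation between monomials to
  \<open>K\<close>-linear relations between \<open>p\<close>-th powers of monomials of smaller degree. Finally, Frobenius
  preserves linear independence over \<open>K\<close> (\<open>independent_power_CHAR\<close>), since it acts on
  coefficients one by one, and induction on the degree finishes the proof.
\<close>

section \<open>Constants and homogeneous parts\<close>

interpretation gs: vector_space "\<lambda>(c::'k::field) (f::('u, 'k) gseries). const_gseries c * f"
  by unfold_locales
     (auto intro!: gseries_eqI
        simp: gs_coeff_const_mult plus_gseries.rep_eq const_gseries.rep_eq distrib_left distrib_right mult.assoc)

lemma const_gseries_0 [simp]: "const_gseries 0 = 0"
  by (rule gseries_eqI) (simp add: const_gseries.rep_eq zero_gseries.rep_eq)

lemma const_gseries_1 [simp]: "const_gseries 1 = 1"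
  by (rule gseries_eqI) (simp add: const_gseries.rep_eq one_gseries.rep_eq)

lemma const_gseries_eq_0_iff [simp]: "const_gseries c = (0 :: ('u, 'k::comm_ring_1) gseries) \<longleftrightarrow> c = 0"
proof
  assume "const_gseries c = (0 :: ('u, 'k) gseries)"
  from arg_cong[OF this, of "\<lambda>f. gs_coeff f 0"] show "c = 0"
    by (simp add: const_gseries.rep_eq zero_gseries.rep_eq)
next
  assume "c = 0"
  then show "const_gseries c = (0 :: ('u, 'k) gseries)"
    by (intro gseries_eqI) (simp add: const_gseries.rep_eq zero_gseries.rep_eq)
qed

lemma const_gseries_add: "const_gseries (a + b) = const_gseries a + (const_gseries b :: ('u, 'k::comm_ring_1) gseries)"
  by (rule gseries_eqI) (simp add: const_gseries.rep_eq plus_gseries.rep_eq)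

lemma const_gseries_mult:
  "const_gseries (a * b) = const_gseries a * (const_gseries b :: ('u, 'k::field) gseries)"
  by (rule gseries_eqI) (simp add: gs_coeff_const_mult const_gseries.rep_eq)

lemma const_gseries_power: "const_gseries (a ^ n) = (const_gseries a :: ('u, 'k::field) gseries) ^ n"
  by (induction n) (simp_all add: const_gseries_mult)

lemma const_gseries_of_nat: "const_gseries (of_nat n) = (of_nat n :: ('u, 'k::field) gseries)"
  by (induction n) (simp_all add: const_gseries_add)

lemma const_gseries_uminus: "const_gseries (- a) = - (const_gseries a :: ('u, 'k::comm_ring_1) gseries)"
  by (rule gseries_eqI) (simp add: const_gseries.rep_eq uminus_gseries.rep_eq)

lemma gs_coeff_diff: "gs_coeff (f - g) e = gs_coeff f e - gs_coeff g e"
  unfolding minus_gseries_def plus_gseries.rep_eq uminus_gseries.rep_eq by simp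

lemma hom_part_add: "hom_part n (f + g) = hom_part n f + (hom_part n g :: ('u, 'k::comm_ring_1) gseries)"
  by (rule gseries_eqI) (simp add: hom_part.rep_eq plus_gseries.rep_eq)

lemma hom_part_const_mult:
  "hom_part n (const_gseries c * f) = const_gseries c * (hom_part n f :: ('u, 'k::field) gseries)"
  by (rule gseries_eqI) (simp add: hom_part.rep_eq gs_coeff_const_mult)

lemma hom_part_homogeneous: "f \<in> homogeneous m \<Longrightarrow> hom_part n f = (if n = m then f else 0)"
  by (rule gseries_eqI) (auto simp: hom_part.rep_eq homogeneous_def zero_gseries.rep_eq)

lemma hom_part_in_homogeneous: "hom_part n f \<in> homogeneous n"
  by (auto simp: homogeneous_def hom_part.rep_eq)

lemma hom_part_0: "hom_part 0 f = const_gseries (gs_coeff f 0)"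
  by (rule gseries_eqI) (auto simp: hom_part.rep_eq const_gseries.rep_eq mdeg_eq_0_iff)

lemma hom_part_mult:
  fixes f g :: "('u, 'k::comm_ring_1) gseries"
  shows "hom_part n (f * g) = (\<Sum>j\<le>n. hom_part j f * hom_part (n - j) g)"
proof (rule gseries_eqI)
  fix e
  have "gs_coeff (\<Sum>j\<le>n. hom_part j f * hom_part (n - j) g) e =
     (\<Sum>(a, b)\<in>{(a, b). a + b = e}. \<Sum>j\<le>n. gs_coeff (hom_part j f) a * gs_coeff (hom_part (n - j) g) b)"
    by (simp add: gs_coeff_sum times_gseries.rep_eq case_prod_unfold) (rule sum.swap)
  also have "\<dots> = (\<Sum>(a, b)\<in>{(a, b). a + b = e}. if mdeg e = n then gs_coeff f a * gs_coeff g b else 0)"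
  proof (rule sum.cong[OF refl], clarify)
    fix a b :: "'u \<Rightarrow>\<^sub>0 nat"
    have "(\<Sum>j\<le>n. gs_coeff (hom_part j f) a * gs_coeff (hom_part (n - j) g) b) =
        (\<Sum>j\<le>n. if j = mdeg a then if mdeg b = n - mdeg a then gs_coeff f a * gs_coeff g b else 0 else 0)"
      by (intro sum.cong) (auto simp: hom_part.rep_eq)
    also have "\<dots> = (if mdeg (a + b) = n then gs_coeff f a * gs_coeff g b else 0)"
      by (auto simp: mdeg_add)
    finally show "(\<Sum>j\<le>n. gs_coeff (hom_part j f) a * gs_coeff (hom_part (n - j) g) b) =
        (if mdeg (a + b) = n then gs_coeff f a * gs_coeff g b else 0)" .
  qed
  also have "\<dots> = gs_coeff (hom_part n (f * g)) e"
    by (simp add: hom_part.rep_eq times_gseries.rep_eq)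
  finally show "gs_coeff (hom_part n (f * g)) e = gs_coeff (\<Sum>j\<le>n. hom_part j f * hom_part (n - j) g) e"
    by (rule sym)
qed

lemma sum_hom_parts: "\<exists>n. f = (\<Sum>j\<le>n. hom_part j (f :: ('u, 'k::comm_ring_1) gseries))"
proof -
  obtain n where n: "\<And>e. gs_coeff f e \<noteq> 0 \<Longrightarrow> mdeg e \<le> n"
    using gs_coeff[of f] by auto
  have "f = (\<Sum>j\<le>n. hom_part j f)"
    by (rule gseries_eqI) (use n in \<open>auto simp: gs_coeff_sum hom_part.rep_eq\<close>)
  then show ?thesis ..
qed

lemma homogeneous_unique_degree:
  assumes "f \<in> homogeneous m" "f \<in> homogeneous n" "f \<noteq> 0"
  shows "m = n"
proof -
  obtain e where "gs_coeff f e \<noteq> 0"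
    using assms(3) by (metis gseries_eqI zero_gseries.rep_eq)
  with assms show ?thesis by (auto simp: homogeneous_def)
qed

section \<open>Hasse derivatives\<close>

lemma mdeg_single [simp]: "mdeg (Poly_Mapping.single i k) = k"
  by (simp add: mdeg_def)

text \<open>
  The binomial coefficient makes \<open>k!\<close> times this operator the \<open>k\<close>-th iterated partial derivative
  with respect to \<open>x\<^sub>i\<close>. The operator itself is defined over the integers, which keeps it
  meaningful when \<open>k!\<close> is not invertible.
\<close>

lift_definition hasse :: "'u \<Rightarrow> nat \<Rightarrow> ('u, 'k::comm_ring_1) gseries \<Rightarrow> ('u, 'k) gseries"
  is "\<lambda>i k f e. of_nat ((Poly_Mapping.lookup e i + k) choose k) * f (e + Poly_Mapping.single i k)"
proof -
  fix i :: 'u and k and f :: "('u \<Rightarrow>\<^sub>0 nat) \<Rightarrow> 'k"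
  assume "\<exists>d. \<forall>e. f e \<noteq> 0 \<longrightarrow> mdeg e \<le> d"
  then obtain d where d: "\<And>e. f e \<noteq> 0 \<Longrightarrow> mdeg e \<le> d" by blast
  have "mdeg e \<le> d" if "of_nat ((Poly_Mapping.lookup e i + k) choose k) * f (e + Poly_Mapping.single i k) \<noteq> 0" for e
  proof -
    have "f (e + Poly_Mapping.single i k) \<noteq> 0" using that by auto
    from d[OF this] show ?thesis by (simp add: mdeg_add)
  qed
  then show "\<exists>d. \<forall>e. of_nat ((Poly_Mapping.lookup e i + k) choose k) *
      f (e + Poly_Mapping.single i k) \<noteq> 0 \<longrightarrow> mdeg e \<le> d" by blast
qed

lemma hasse_0 [simp]: "hasse i 0 f = f"
  by (rule gseries_eqI) (simp add: hasse.rep_eq)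

lemma hasse_add: "hasse i k (f + g) = hasse i k f + hasse i k g"
  by (rule gseries_eqI) (simp add: hasse.rep_eq plus_gseries.rep_eq algebra_simps)

lemma hasse_const: "k > 0 \<Longrightarrow> hasse i k (const_gseries c) = 0"
proof (rule gseries_eqI)
  fix e assume "k > 0"
  then have "mdeg (e + Poly_Mapping.single i k) \<noteq> 0"
    by (simp add: mdeg_add)
  then show "gs_coeff (hasse i k (const_gseries c)) e = gs_coeff 0 e"
    by (auto simp: hasse.rep_eq const_gseries.rep_eq zero_gseries.rep_eq mdeg_eq_0_iff)
qed

text \<open>
  On each pair of monomials the Leibniz rule is Vandermonde's identity for binomial coefficients.
\<close>

lemma hasse_mult:
  fixes f g :: "('u, 'k::comm_ring_1) gseries"
  shows "hasse i k (f * g) = (\<Sum>j\<le>k. hasse i j f * hasse i (k - j) g)"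
proof (rule gseries_eqI)
  fix e :: "'u \<Rightarrow>\<^sub>0 nat"
  let ?l = "\<lambda>a. Poly_Mapping.lookup a i" and ?s = "Poly_Mapping.single i"
  let ?D = "\<lambda>e :: 'u \<Rightarrow>\<^sub>0 nat. {(a, b). a + b = e}"
  let ?t = "\<lambda>((a, b), j). of_nat ((?l a choose j) * (?l b choose (k - j))) * (gs_coeff f a * gs_coeff g b)"
  let ?E = "{((a, b), j). a + b = e + ?s k \<and> j \<le> k \<and> j \<le> ?l a \<and> k - j \<le> ?l b}"
  have fin: "finite (?D (e + ?s k) \<times> {..k})"
    by (simp add: finite_decompositions)
  have split: "e + ?s k = (e + ?s j) + ?s (k - j)" if "j \<le> k" for e j
    using that by (simp add: add.assoc flip: single_add)
  have "gs_coeff (hasse i k (f * g)) e =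
      (\<Sum>(a, b)\<in>?D (e + ?s k). of_nat ((?l e + k) choose k) * (gs_coeff f a * gs_coeff g b))"
    by (simp add: hasse.rep_eq times_gseries.rep_eq sum_distrib_left case_prod_unfold)
  also have "\<dots> = (\<Sum>x\<in>?D (e + ?s k). \<Sum>j\<le>k. ?t (x, j))"
  proof (rule sum.cong[OF refl])
    fix x assume "x \<in> ?D (e + ?s k)"
    then obtain a b where x: "x = (a, b)" and ab: "a + b = e + ?s k"
      by blast
    have "?l e + k = ?l a + ?l b"
      using arg_cong[OF ab, of ?l] by (simp add: lookup_add)
    then have "(?l e + k) choose k = (\<Sum>j\<le>k. (?l a choose j) * (?l b choose (k - j)))"
      by (simp add: vandermonde)
    then show "(case x of (a, b) \<Rightarrow> of_nat ((?l e + k) choose k) * (gs_coeff f a * gs_coeff g b)) = (\<Sum>j\<le>k. ?t (x, j))"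
      by (simp add: sum_distrib_right x)
  qed
  also have "\<dots> = (\<Sum>x\<in>?D (e + ?s k) \<times> {..k}. ?t x)"
    by (simp add: sum.cartesian_product case_prod_unfold)
  also have "\<dots> = (\<Sum>x\<in>?E. ?t x)"
    by (rule sum.mono_neutral_right[OF fin]) (auto, (metis binomial_eq_0 mult_zero_left mult_zero_right not_le_imp_less of_nat_0)+)
  also have "\<dots> = (\<Sum>(j, (u, v))\<in>{..k} \<times> ?D e. gs_coeff (hasse i j f) u * gs_coeff (hasse i (k - j) g) v)"
  proof -
    let ?f = "\<lambda>(j, (u, v)). ((u + ?s j, v + ?s (k - j)), j)"
    let ?g = "\<lambda>((a, b), j). (j, (a - ?s j, b - ?s (k - j)))"
    let ?h = "\<lambda>(j, (u, v)). gs_coeff (hasse i j f) u * gs_coeff (hasse i (k - j) g) v"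
    show ?thesis
    proof (rule sum.reindex_bij_witness[of _ ?f ?g])
      fix x assume "x \<in> ?E"
      then obtain a b j where x: "x = ((a, b), j)" and ab: "a + b = e + ?s k"
        and j: "j \<le> k" "j \<le> ?l a" "k - j \<le> ?l b"
        by auto
      have a: "a - ?s j + ?s j = a" and b: "b - ?s (k - j) + ?s (k - j) = b"
        using j by (auto intro!: poly_mapping_eqI simp: lookup_add lookup_minus lookup_single when_def)
      show "?f (?g x) = x"
        using a b x by simp
      have "(a - ?s j + (b - ?s (k - j))) + ?s k = (a - ?s j + ?s j) + (b - ?s (k - j) + ?s (k - j))"
        unfolding split[OF j(1)] by (simp only: ac_simps)
      then have "a - ?s j + (b - ?s (k - j)) = e"
        unfolding a b ab by simp
      then show "?g x \<in> {..k} \<times> ?D e"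
        using x j by simp
      have "?l (a - ?s j) + j = ?l a" "?l (b - ?s (k - j)) + (k - j) = ?l b"
        using j by (auto simp: lookup_minus)
      then show "?h (?g x) = ?t x"
        by (simp only: x prod.case hasse.rep_eq a b) (simp add: algebra_simps)
    next
      fix y assume "y \<in> {..k} \<times> ?D e"
      then obtain j u v where y: "y = (j, (u, v))" "j \<le> k" "u + v = e" by auto
      then show "?g (?f y) = y" by simp
      show "?f y \<in> ?E"
        using y split[OF y(2), of e] by (auto simp: lookup_add ac_simps)
    qed
  qed
  also have "\<dots> = gs_coeff (\<Sum>j\<le>k. hasse i j f * hasse i (k - j) g) e"
    by (simp add: gs_coeff_sum times_gseries.rep_eq sum.cartesian_product case_prod_unfold)
  finally show "gs_coeff (hasse i k (f * g)) e = gs_coeff (\<Sum>j\<le>k. hasse i j f * hasse i (k - j) g) e" .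
qed

lemma hasse_const_mult:
  "hasse i k (const_gseries c * f) = const_gseries c * (hasse i k f :: ('u, 'k::field) gseries)"
  by (rule gseries_eqI) (simp add: hasse.rep_eq gs_coeff_const_mult mult.left_commute)

text \<open>
  A non-constant monomial of \<open>f\<close> in which \<open>x\<^sub>i\<close> has exponent \<open>k > 0\<close> contributes to
  \<open>hasse i k f\<close> with binomial coefficient \<open>1\<close>, whatever the characteristic.
\<close>

lemma const_if_hasse_eq_0:
  assumes "\<And>i k. k > 0 \<Longrightarrow> hasse i k f = 0"
  shows "f = const_gseries (gs_coeff f 0)"
proof (rule gseries_eqI)
  fix e
  show "gs_coeff f e = gs_coeff (const_gseries (gs_coeff f 0)) e"
  proof (cases "e = 0")
    case False
    then obtain i where i: "Poly_Mapping.lookup e i \<noteq> 0"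
      by (metis lookup_zero poly_mapping_eqI)
    let ?k = "Poly_Mapping.lookup e i"
    have e: "e - Poly_Mapping.single i ?k + Poly_Mapping.single i ?k = e"
      by (auto intro!: poly_mapping_eqI simp: lookup_add lookup_minus lookup_single when_def)
    have "gs_coeff (hasse i ?k f) (e - Poly_Mapping.single i ?k) = gs_coeff f e"
      by (simp add: hasse.rep_eq e lookup_minus)
    with assms[of ?k i] i False show ?thesis
      by (simp add: zero_gseries.rep_eq const_gseries.rep_eq)
  qed (simp add: const_gseries.rep_eq)
qed

lemma hasse_homogeneous:
  assumes "f \<in> homogeneous m"
  shows "hasse i k f \<in> homogeneous (m - k)"
  unfolding homogeneous_def
proof (intro CollectI allI impI)
  fix e assume "gs_coeff (hasse i k f) e \<noteq> 0"
  then have "gs_coeff f (e + Poly_Mapping.single i k) \<noteq> 0"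
    by (auto simp: hasse.rep_eq)
  then have "mdeg e + k = m"
    using assms by (auto simp: homogeneous_def mdeg_add)
  then show "mdeg e = m - k" by simp
qed

lemma hasse_eq_0_if_degree_less:
  assumes "f \<in> homogeneous m" "m < k"
  shows "hasse i k f = 0"
proof (rule gseries_eqI)
  fix e
  have "gs_coeff f (e + Poly_Mapping.single i k) = 0"
    using assms mdeg_add[of e "Poly_Mapping.single i k"] by (auto simp: homogeneous_def)
  then show "gs_coeff (hasse i k f) e = gs_coeff 0 e"
    by (simp add: hasse.rep_eq zero_gseries.rep_eq)
qed

text \<open>
  This is the Taylor expansion \<open>f(x\<^sub>i + t)\<close> in a new variable \<open>t\<close>. It packages the Leibniz rule as the
  statement that \<open>taylor i\<close> is a ring homomorphism, so that powers can be handled by the binomial theorem.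
\<close>

definition taylor :: "'u \<Rightarrow> ('u, 'k::comm_ring_1) gseries \<Rightarrow> ('u, 'k) gseries fps" where
  "taylor i f = Abs_fps (\<lambda>k. hasse i k f)"

lemma taylor_nth [simp]: "fps_nth (taylor i f) k = hasse i k f"
  by (simp add: taylor_def)

lemma taylor_add: "taylor i (f + g) = taylor i f + taylor i g"
  by (rule fps_ext) (simp add: hasse_add)

lemma taylor_mult: "taylor i (f * g) = taylor i f * taylor i g"
  by (rule fps_ext) (simp add: hasse_mult fps_mult_nth atMost_atLeast0)

lemma taylor_const: "taylor i (const_gseries c) = fps_const (const_gseries c)"
  by (rule fps_ext) (auto simp: hasse_const)

lemma taylor_1 [simp]: "taylor i 1 = (1 :: ('u, 'k::comm_ring_1) gseries fps)"
  using taylor_const[of i "1::'k"] by simp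

lemma taylor_0 [simp]: "taylor i 0 = (0 :: ('u, 'k::comm_ring_1) gseries fps)"
  using taylor_const[of i "0::'k"] by simp

lemma taylor_power: "taylor i (f ^ n) = taylor i f ^ n"
  by (induction n) (simp_all add: taylor_mult)

lemma taylor_sum: "taylor i (\<Sum>x\<in>S. f x) = (\<Sum>x\<in>S. taylor i (f x))"
  by (induction S rule: infinite_finite_induct) (simp_all add: taylor_add)

section \<open>Subrings and generated subalgebras\<close>

lemma is_subring_power: "is_subring A \<Longrightarrow> a \<in> A \<Longrightarrow> a ^ n \<in> A"
  by (induction n) (auto simp: is_subring_def)

lemma is_subring_prod:
  assumes "is_subring A" "\<And>i. i \<in> I \<Longrightarrow> f i \<in> A"
  shows "prod f I \<in> A"
  using assms by (induction I rule: infinite_finite_induct) (auto simp: is_subring_def)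

lemma is_subring_of_nat: "is_subring A \<Longrightarrow> of_nat n \<in> A"
  by (induction n) (auto simp: is_subring_def)

text \<open>
  Power series with coefficients in a subring are not a separate type, hence their closure
  under products and powers is expressed coefficient by coefficient.
\<close>

lemma is_subring_fps_nth_mult:
  assumes "is_subring A" "\<And>k. fps_nth F k \<in> A" "\<And>k. fps_nth G k \<in> A"
  shows "fps_nth (F * G) k \<in> A"
  unfolding fps_mult_nth by (rule is_subring_sum[OF assms(1)]) (use assms in \<open>auto simp: is_subring_def\<close>)

lemma is_subring_fps_nth_power:
  assumes "is_subring A" "\<And>k. fps_nth F k \<in> A"
  shows "fps_nth (F ^ n) k \<in> A"
proof (induction n arbitrary: k)
  case 0
  then show ?case using assms(1) by (simp add: is_subring_def)
next
  case (Suc n)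
  then show ?case using is_subring_fps_nth_mult[OF assms(1), of F "F ^ n"] assms(2) by simp
qed

inductive_set gen_alg :: "('u, 'k::comm_ring_1) gseries set \<Rightarrow> ('u, 'k) gseries set"
  for G where
  const: "const_gseries c \<in> gen_alg G"
| gen: "g \<in> G \<Longrightarrow> g \<in> gen_alg G"
| add: "f \<in> gen_alg G \<Longrightarrow> g \<in> gen_alg G \<Longrightarrow> f + g \<in> gen_alg G"
| mult: "f \<in> gen_alg G \<Longrightarrow> g \<in> gen_alg G \<Longrightarrow> f * g \<in> gen_alg G"

lemma gen_alg_mono:
  assumes "G \<subseteq> H"
  shows "gen_alg G \<subseteq> gen_alg H"
proof
  fix f assume "f \<in> gen_alg G"
  then show "f \<in> gen_alg H"
    by induction (use assms in \<open>auto intro: gen_alg.intros\<close>)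
qed

lemma is_subring_gen_alg: "is_subring (gen_alg (G :: ('u, 'k::field) gseries set))"
proof -
  have "- f \<in> gen_alg G" if "f \<in> gen_alg G" for f
    using gen_alg.mult[OF gen_alg.const[of "-1"] that] by (simp add: const_gseries_uminus)
  then show ?thesis
    using gen_alg.const[of 0 G] gen_alg.const[of 1 G]
    by (auto simp: is_subring_def intro: gen_alg.add gen_alg.mult)
qed

lemma gen_alg_power: "f \<in> gen_alg G \<Longrightarrow> f ^ n \<in> gen_alg (G :: ('u, 'k::field) gseries set)"
  by (rule is_subring_power[OF is_subring_gen_alg])

lemma gen_alg_sum:
  "(\<And>x. x \<in> I \<Longrightarrow> f x \<in> gen_alg G) \<Longrightarrow> sum f I \<in> gen_alg (G :: ('u, 'k::field) gseries set)"
  by (rule is_subring_sum[OF is_subring_gen_alg])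

lemma gen_alg_prod:
  "(\<And>x. x \<in> I \<Longrightarrow> f x \<in> gen_alg G) \<Longrightarrow> prod f I \<in> gen_alg (G :: ('u, 'k::field) gseries set)"
  by (rule is_subring_prod[OF is_subring_gen_alg])

lemma hasse_const_in_gen_alg: "hasse i k (const_gseries c) \<in> gen_alg G"
  using gen_alg.const[of c G] gen_alg.const[of 0 G] by (cases "k = 0") (simp_all add: hasse_const)

lemma hasse_in_gen_alg:
  fixes G :: "('u, 'k::field) gseries set"
  assumes G: "\<And>g k. g \<in> G \<Longrightarrow> hasse i k g \<in> gen_alg G" and f: "f \<in> gen_alg G"
  shows "hasse i k f \<in> gen_alg G"
  using f
proof (induction arbitrary: k)
  case (const c)
  show ?case by (rule hasse_const_in_gen_alg)
next
  case (gen g)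
  then show ?case by (rule G)
next
  case (add f g)
  then show ?case by (simp add: hasse_add gen_alg.add)
next
  case (mult f g)
  then show ?case by (auto simp: hasse_mult intro!: gen_alg_sum gen_alg.mult)
qed

section \<open>The Frobenius map\<close>

lemma CHAR_gseries: "CHAR(('u, 'k::field) gseries) = CHAR('k)"
proof (rule CHAR_eqI)
  show "of_nat CHAR('k) = (0 :: ('u, 'k) gseries)"
    by (simp flip: const_gseries_of_nat)
  fix n assume "of_nat n = (0 :: ('u, 'k) gseries)"
  then have "gs_coeff (const_gseries (of_nat n) :: ('u, 'k) gseries) 0 = 0"
    by (simp add: const_gseries_of_nat zero_gseries.rep_eq)
  then show "CHAR('k) dvd n"
    by (simp add: const_gseries.rep_eq of_nat_eq_0_iff_char_dvd)
qed

definition monom_gseries :: "('u \<Rightarrow>\<^sub>0 nat) \<Rightarrow> 'k::zero \<Rightarrow> ('u, 'k) gseries" where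
  "monom_gseries v c = Abs_gseries (\<lambda>e. if e = v then c else 0)"

lemma gs_coeff_monom: "gs_coeff (monom_gseries v c) e = (if e = v then c else 0)"
  unfolding monom_gseries_def by (subst Abs_gseries_inverse) auto

lemma monom_gseries_mult:
  "monom_gseries v c * monom_gseries w d = (monom_gseries (v + w) (c * d) :: ('u, 'k::comm_ring_1) gseries)"
proof (rule gseries_eqI)
  fix e
  have "gs_coeff (monom_gseries v c * monom_gseries w d) e =
      (\<Sum>x\<in>{(a, b). a + b = e}. if x = (v, w) then c * d else 0)"
    unfolding times_gseries.rep_eq gs_coeff_monom
    by (rule sum.cong) (auto split: if_splits)
  then show "gs_coeff (monom_gseries v c * monom_gseries w d) e = gs_coeff (monom_gseries (v + w) (c * d)) e"
    by (auto simp: finite_decompositions gs_coeff_monom)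
qed

lemma monom_gseries_power:
  "monom_gseries v c ^ n = (monom_gseries (\<Sum>_<n. v) (c ^ n) :: ('u, 'k::comm_ring_1) gseries)"
proof (induction n)
  case 0
  show ?case by (rule gseries_eqI) (simp add: gs_coeff_monom one_gseries.rep_eq)
qed (simp add: monom_gseries_mult add.commute)

text \<open>
  Additivity of Frobenius only applies to finite sums. Since only the finitely many monomials
  dividing \<open>x\<^sup>p\<^sup>e\<close> can matter for the coefficient at that place, \<open>f\<close> is split accordingly into a
  finite sum of monomials and a remainder whose \<open>p\<close>-th power does not contribute. The multi-index \<open>p e\<close>
  is written as a sum of \<open>p\<close> copies of \<open>e\<close>.
\<close>

lemma gs_coeff_power_CHAR:
  fixes f :: "('u, 'k::field) gseries"
  assumes p: "p = CHAR('k)" "p > 0"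
  shows "gs_coeff (f ^ p) (\<Sum>_<p. e) = gs_coeff f e ^ p"
proof -
  let ?pe = "\<Sum>_<p. e"
  have prime: "prime CHAR(('u, 'k) gseries)" "p = CHAR(('u, 'k) gseries)"
    using p by (auto simp: CHAR_gseries prime_CHAR_semidom)
  \<comment> \<open>The exponents of the monomials that divide \<open>x\<^sup>p\<^sup>e\<close>.\<close>
  define V where "V = fst ` {(a, b). a + b = ?pe}"
  have V: "finite V" "a \<in> V" if "a + b = ?pe" for a b
    unfolding V_def using that by (force simp: finite_decompositions)+
  have "?pe = e + (\<Sum>_<p-1. e)"
    using p(2) by (cases p) (simp_all add: add.commute)
  then have eV: "e \<in> V" and finV: "finite V"
    using V by metis+
  define g where "g = (\<Sum>v\<in>V. monom_gseries v (gs_coeff f v))"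
  define h where "h = f - g"
  have g: "gs_coeff g v = (if v \<in> V then gs_coeff f v else 0)" for v
    using finV by (auto simp: g_def gs_coeff_sum gs_coeff_monom)
  have h: "gs_coeff h v = 0" if "v \<in> V" for v
    using that by (simp add: h_def gs_coeff_diff g)
  have "h ^ p = h * h ^ (p - 1)"
    using p(2) by (cases p) simp_all
  then have "gs_coeff (h ^ p) ?pe = (\<Sum>(a, b)\<in>{(a, b). a + b = ?pe}. gs_coeff h a * gs_coeff (h ^ (p - 1)) b)"
    by (simp add: times_gseries.rep_eq)
  also have "\<dots> = 0"
    using h V(2) by (intro sum.neutral) auto
  finally have hp: "gs_coeff (h ^ p) ?pe = 0" .
  have inj: "(\<Sum>_<p. v) = ?pe \<longleftrightarrow> v = e" for v
  proof
    assume *: "(\<Sum>_<p. v) = ?pe"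
    show "v = e"
    proof (rule poly_mapping_eqI)
      fix i show "Poly_Mapping.lookup v i = Poly_Mapping.lookup e i"
        using arg_cong[OF *, of "\<lambda>v. Poly_Mapping.lookup v i"] p(2) by (simp add: lookup_sum)
    qed
  qed simp
  have "f ^ p = (g + h) ^ p"
    by (simp add: h_def)
  also have "\<dots> = g ^ p + h ^ p"
    by (rule freshmans_dream[OF prime])
  finally have "gs_coeff (f ^ p) ?pe = gs_coeff (g ^ p) ?pe"
    by (simp add: plus_gseries.rep_eq hp)
  also have "g ^ p = (\<Sum>v\<in>V. monom_gseries (\<Sum>_<p. v) (gs_coeff f v ^ p))"
    unfolding g_def by (simp add: freshmans_dream_sum[OF prime] monom_gseries_power)
  also have "gs_coeff \<dots> ?pe = (\<Sum>v\<in>V. if v = e then gs_coeff f v ^ p else 0)"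
    unfolding gs_coeff_sum gs_coeff_monom by (intro sum.cong) (auto simp: inj eq_commute[of ?pe])
  also have "\<dots> = gs_coeff f e ^ p"
    using eV finV by simp
  finally show ?thesis .
qed

text \<open>
  One step of Gaussian elimination: if \<open>g\<^sub>m\<close> does not vanish at \<open>e\<^sub>0\<close>, subtract a multiple of it
  from the other functions to make them vanish at \<open>e\<^sub>0\<close>. Frobenius is additive, so it turns this
  elimination into the corresponding one for the \<open>p\<close>-th powers; evaluation at \<open>e\<^sub>0\<close> then removes
  \<open>g\<^sub>m\<close> from the relation.
\<close>

lemma independent_power_CHAR_functions:
  fixes g :: "'i \<Rightarrow> 'e \<Rightarrow> 'k::field"
  assumes p: "p = CHAR('k)" "p > 0" and I: "finite I"
    and indep: "\<And>b. (\<And>e. (\<Sum>i\<in>I. b i * g i e) = 0) \<Longrightarrow> \<forall>i\<in>I. b i = 0"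
    and rel: "\<And>e. (\<Sum>i\<in>I. a i * g i e ^ p) = 0"
  shows "\<forall>i\<in>I. a i = 0"
  using I indep rel
proof (induction I arbitrary: g a rule: finite_induct)
  case (insert m I)
  have prime: "prime CHAR('k)"
    using p by (simp add: prime_CHAR_semidom)
  have "\<exists>e. g m e \<noteq> 0"
  proof (rule ccontr)
    assume "\<not> (\<exists>e. g m e \<noteq> 0)"
    then have "(\<Sum>i\<in>insert m I. (if i = m then 1 else 0) * g i e) = 0" for e
      using insert.hyps by (auto intro!: sum.neutral)
    from insert.prems(1)[OF this] show False
      by simp
  qed
  then obtain e0 where e0: "g m e0 \<noteq> 0" ..
  define r where "r i = g i e0 / g m e0" for i
  define g' where "g' i e = g i e - r i * g m e" for i e
  have g'_indep: "\<forall>i\<in>I. b i = 0" if b: "\<And>e. (\<Sum>i\<in>I. b i * g' i e) = 0" for b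
  proof -
    define b' where "b' i = (if i = m then - (\<Sum>i\<in>I. b i * r i) else b i)" for i
    have "(\<Sum>i\<in>insert m I. b' i * g i e) = (\<Sum>i\<in>I. b i * g i e) - (\<Sum>i\<in>I. b i * r i) * g m e" for e
    proof -
      have "(\<Sum>i\<in>I. b' i * g i e) = (\<Sum>i\<in>I. b i * g i e)"
        using insert.hyps by (intro sum.cong) (auto simp: b'_def)
      then show ?thesis
        using insert.hyps by (simp add: b'_def)
    qed
    also have "(\<Sum>i\<in>I. b i * g i e) - (\<Sum>i\<in>I. b i * r i) * g m e = (\<Sum>i\<in>I. b i * g' i e)" for e
      by (simp add: g'_def algebra_simps sum_subtractf sum_distrib_left)
    finally have "(\<Sum>i\<in>insert m I. b' i * g i e) = 0" for e
      using b by simp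
    from insert.prems(1)[OF this] show ?thesis
      using insert.hyps by (auto simp: b'_def split: if_splits)
  qed
  \<comment> \<open>The coefficient of \<open>g\<^sub>m\<^sup>p\<close> after the elimination.\<close>
  define s where "s = a m + (\<Sum>i\<in>I. a i * r i ^ p)"
  have split: "(\<Sum>i\<in>I. a i * g' i e ^ p) + s * g m e ^ p = 0" for e
  proof -
    have "a i * g i e ^ p = a i * g' i e ^ p + a i * r i ^ p * g m e ^ p" for i
    proof -
      have "g i e ^ p = g' i e ^ p + r i ^ p * g m e ^ p"
        using freshmans_dream[OF prime p(1), of "g' i e" "r i * g m e"]
        by (simp add: g'_def power_mult_distrib)
      then show ?thesis by (simp only: distrib_left mult.assoc)
    qed
    from sum.cong[OF refl this]
    have "(\<Sum>i\<in>I. a i * g i e ^ p) = (\<Sum>i\<in>I. a i * g' i e ^ p + a i * r i ^ p * g m e ^ p)" .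
    then have "(\<Sum>i\<in>insert m I. a i * g i e ^ p) = (\<Sum>i\<in>I. a i * g' i e ^ p) + s * g m e ^ p"
      using insert.hyps by (simp add: s_def distrib_right sum.distrib sum_distrib_right)
    with insert.prems(2) show ?thesis by simp
  qed
  have "g' i e0 = 0" for i
    using e0 by (simp add: g'_def r_def)
  then have "(\<Sum>i\<in>I. a i * g' i e0 ^ p) = 0"
    using p(2) by (intro sum.neutral) (simp add: power_0_left)
  then have "s * g m e0 ^ p = 0"
    using split[of e0] by (simp only: add_0)
  then have "s = 0"
    using e0 by simp
  have "\<forall>i\<in>I. a i = 0"
  proof (rule insert.IH[of g'])
    show "(\<Sum>i\<in>I. a i * g' i e ^ p) = 0" for e
      using split[of e] \<open>s = 0\<close> by simp
  qed (rule g'_indep)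
  with \<open>s = 0\<close> show ?case
    by (simp add: s_def)
qed simp

text \<open>
  The coefficient of \<open>f\<^sup>p\<close> at \<open>x\<^sup>p\<^sup>e\<close> is the \<open>p\<close>-th power of the coefficient of \<open>f\<close> at \<open>x\<^sup>e\<close>, so this is
  the statement for functions applied to the coefficient functions. It says that
  the \<open>K\<close>-span of the \<open>p\<close>-th powers is a Frobenius twist of the whole ring, even when \<open>K\<close> is imperfect.
\<close>

lemma independent_power_CHAR:
  fixes g :: "'i \<Rightarrow> ('u, 'k::field) gseries"
  assumes p: "p = CHAR('k)" "p > 0" and I: "finite I"
    and indep: "\<And>b. (\<Sum>i\<in>I. const_gseries (b i) * g i) = 0 \<Longrightarrow> \<forall>i\<in>I. b i = 0"
    and rel: "(\<Sum>i\<in>I. const_gseries (a i) * g i ^ p) = 0"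
  shows "\<forall>i\<in>I. a i = 0"
proof (rule independent_power_CHAR_functions[OF p I, of "\<lambda>i. gs_coeff (g i)"])
  fix b :: "'i \<Rightarrow> 'k"
  assume "\<And>e. (\<Sum>i\<in>I. b i * gs_coeff (g i) e) = 0"
  then have "(\<Sum>i\<in>I. const_gseries (b i) * g i) = 0"
    by (intro gseries_eqI) (simp add: gs_coeff_sum gs_coeff_const_mult zero_gseries.rep_eq)
  then show "\<forall>i\<in>I. b i = 0" by (rule indep)
next
  fix e
  show "(\<Sum>i\<in>I. a i * gs_coeff (g i) e ^ p) = 0"
    using arg_cong[OF rel, of "\<lambda>f. gs_coeff f (\<Sum>_<p. e)"]
    by (simp add: gs_coeff_sum gs_coeff_const_mult gs_coeff_power_CHAR[OF p] zero_gseries.rep_eq)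
qed

lemma power_CHAR_in_gen_alg_powers:
  fixes X :: "('u, 'k::field) gseries set"
  assumes p: "p = CHAR('k)" "p > 0" and f: "f \<in> gen_alg X"
  shows "f ^ p \<in> gen_alg ((\<lambda>x. x ^ p) ` X)"
  using f
proof induction
  case (const c)
  show ?case
    using gen_alg.const[of "c ^ p"] by (simp add: const_gseries_power)
next
  case (add f g)
  have "(f + g) ^ p = f ^ p + g ^ p"
    using p by (intro freshmans_dream) (simp_all add: CHAR_gseries prime_CHAR_semidom)
  with add show ?case by (simp add: gen_alg.add)
qed (auto simp: power_mult_distrib intro: gen_alg.gen gen_alg.mult)

text \<open>
  Applying additivity of Frobenius to the Taylor series of \<open>f\<close> shows that \<open>hasse i k (f ^ p)\<close> is \<open>0\<close> or the
  \<open>p\<close>-th power of a Hasse derivative of \<open>f\<close>. In characteristic \<open>0\<close>, the \<open>p\<close>-th powers are all \<open>1\<close>.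
\<close>

lemma hasse_power_CHAR:
  fixes X :: "('u, 'k::field) gseries set"
  assumes p: "p = CHAR('k)" and f: "\<And>j. hasse i j f \<in> gen_alg X"
  shows "hasse i k (f ^ p) \<in> gen_alg ((\<lambda>x. x ^ p) ` X)"
proof (cases "p = 0")
  case True
  then show ?thesis
    using hasse_const_in_gen_alg[of i k 1] by simp
next
  case False
  let ?C = "gen_alg ((\<lambda>x. x ^ p) ` X)"
  have prime: "prime CHAR(('u, 'k) gseries fps)" "p = CHAR(('u, 'k) gseries fps)"
    using p False by (simp_all add: CHAR_gseries prime_CHAR_semidom)
  define F where "F = taylor i f"
  \<comment> \<open>Frobenius is applied to finite sums only; the terms of \<open>F\<close> beyond \<open>t\<^sup>k\<close> do not affect the coefficient of \<open>t\<^sup>k\<close>.\<close>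
  define L where "L = (\<Sum>j\<le>k. fps_const (fps_nth F j) * fps_X ^ j)"
  define T where "T = fps_shift (Suc k) F"
  have "F = T * fps_X ^ Suc k + L"
  proof (rule fps_ext)
    fix n
    have "fps_nth L n = (\<Sum>j\<le>k. if n = j then fps_nth F j else 0)"
      unfolding L_def fps_sum_nth by (intro sum.cong) simp_all
    then have "fps_nth L n = (if n \<le> k then fps_nth F n else 0)"
      by simp
    then show "fps_nth F n = fps_nth (T * fps_X ^ Suc k + L) n"
      by (simp add: T_def fps_X_power_mult_right_nth del: power_Suc)
  qed
  then have "F ^ p = (T * fps_X ^ Suc k) ^ p + L ^ p"
    using freshmans_dream[OF prime] by simp
  also have "(T * fps_X ^ Suc k) ^ p = T ^ p * fps_X ^ (Suc k * p)"
    by (simp only: power_mult_distrib power_mult)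
  also have "L ^ p = (\<Sum>j\<le>k. fps_const (fps_nth F j ^ p) * fps_X ^ (j * p))"
    unfolding L_def by (simp add: freshmans_dream_sum[OF prime] power_mult_distrib power_mult fps_const_power)
  finally have "fps_nth (F ^ p) k = fps_nth (T ^ p * fps_X ^ (Suc k * p)) k
      + (\<Sum>j\<le>k. fps_nth (fps_const (fps_nth F j ^ p) * fps_X ^ (j * p)) k)"
    by (simp only: fps_add_nth fps_sum_nth)
  also have "fps_nth (T ^ p * fps_X ^ (Suc k * p)) k = 0"
  proof -
    have "k < Suc k * p" using False by (cases p) auto
    then show ?thesis by (simp only: fps_X_power_mult_right_nth if_True)
  qed
  also have "0 + (\<Sum>j\<le>k. fps_nth (fps_const (fps_nth F j ^ p) * fps_X ^ (j * p)) k) \<in> ?C"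
  proof -
    have "fps_nth F j ^ p \<in> ?C" for j
      using power_CHAR_in_gen_alg_powers[OF p _ f] False by (simp add: F_def)
    then have "fps_nth (fps_const (fps_nth F j ^ p) * fps_X ^ (j * p)) k \<in> ?C" for j
      using gen_alg.const[of 0 "(\<lambda>x. x ^ p) ` X"] by simp
    then show ?thesis by (auto intro!: gen_alg_sum)
  qed
  finally show ?thesis
    by (simp add: F_def flip: taylor_power)
qed

section \<open>Powers of one element over a Hasse-stable subalgebra\<close>

text \<open>
  Write the Taylor series of \<open>y\<close> as \<open>y + \<eta>\<close>. Expanding its powers by the binomial theorem
  rearranges the derivative of a polynomial in \<open>y\<close> as a polynomial in \<open>y\<close> again, whose coefficients only
  involve \<open>\<eta>\<close> and the Taylor series of the old coefficients.
\<close>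

lemma hasse_power_sum:
  fixes y :: "('u, 'k::field) gseries"
  shows "hasse i k (\<Sum>b\<le>n. d b * y ^ b) =
    (\<Sum>r\<le>n. (\<Sum>b\<le>n. of_nat (b choose r) *
        fps_nth (taylor i (d b) * (taylor i y - fps_const y) ^ (b - r)) k) * y ^ r)"
proof -
  define \<eta> where "\<eta> = taylor i y - fps_const y"
  have ty: "taylor i y ^ b = (\<Sum>r\<le>n. of_nat (b choose r) * fps_const y ^ r * \<eta> ^ (b - r))" if "b \<le> n" for b
  proof -
    have "taylor i y ^ b = (\<Sum>r\<le>b. of_nat (b choose r) * fps_const y ^ r * \<eta> ^ (b - r))"
      using binomial_ring[of "fps_const y" \<eta> b] by (simp add: \<eta>_def)
    also have "\<dots> = (\<Sum>r\<le>n. of_nat (b choose r) * fps_const y ^ r * \<eta> ^ (b - r))"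
      using that by (intro sum.mono_neutral_left) (auto simp: binomial_eq_0)
    finally show ?thesis .
  qed
  have nth: "fps_nth (of_nat m * fps_const a * F) k = of_nat m * fps_nth F k * a" for m a and F :: "('u, 'k) gseries fps"
    by (simp add: mult.assoc mult.commute fps_of_nat[symmetric] del: fps_of_nat)
  have "taylor i (\<Sum>b\<le>n. d b * y ^ b) =
      (\<Sum>b\<le>n. taylor i (d b) * (\<Sum>r\<le>n. of_nat (b choose r) * fps_const y ^ r * \<eta> ^ (b - r)))"
    by (simp add: taylor_sum taylor_mult taylor_power ty)
  also have "\<dots> = (\<Sum>b\<le>n. \<Sum>r\<le>n. of_nat (b choose r) * fps_const (y ^ r) * (taylor i (d b) * \<eta> ^ (b - r)))"
    by (simp add: sum_distrib_left fps_const_power algebra_simps)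
  also have "\<dots> = (\<Sum>r\<le>n. \<Sum>b\<le>n. of_nat (b choose r) * fps_const (y ^ r) * (taylor i (d b) * \<eta> ^ (b - r)))"
    by (rule sum.swap)
  finally have "fps_nth (taylor i (\<Sum>b\<le>n. d b * y ^ b)) k = fps_nth \<dots> k"
    by simp
  then show ?thesis
    by (simp add: fps_sum_nth nth sum_distrib_right \<eta>_def)
qed

text \<open>
  The induction is on the order \<open>e\<close> of the relation and, inside it, on the degree of its leading
  coefficient. Differentiating lowers the latter, which forces the leading coefficient to be a
  constant; then differentiating lowers the order.
\<close>

lemma powers_independent_over_hasse_stable:
  fixes y :: "('u, 'k::field) gseries"
  assumes B: "is_subring B" "range const_gseries \<subseteq> B"
    and stable: "\<And>i k f. f \<in> B \<Longrightarrow> hasse i k f \<in> B"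
    and y: "\<And>i k. k > 0 \<Longrightarrow> hasse i k y \<in> B" "y \<notin> B"
    and e: "\<And>b. 0 < b \<Longrightarrow> b \<le> e \<Longrightarrow> of_nat b \<noteq> (0::'k)"
    and d: "\<And>b. b \<le> e \<Longrightarrow> d b \<in> B" and rel: "(\<Sum>b\<le>e. d b * y ^ b) = 0"
  shows "\<forall>b\<le>e. d b = 0"
  using e d rel
proof (induction e arbitrary: d)
  case 0
  then show ?case by simp
next
  case (Suc e)
  note outer_IH = Suc.IH and Suc_prems_e = Suc.prems(1)
  \<comment> \<open>The coefficients of the relation obtained by applying \<open>hasse i k\<close> to the relation \<open>d\<close>.\<close>
  define d' where "d' d i k r = (\<Sum>b\<le>Suc e. of_nat (b choose r) *
      fps_nth (taylor i (d b) * (taylor i y - fps_const y) ^ (b - r)) k)" for d i k r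
  have d'_in: "d' d i k r \<in> B" if "\<And>b. b \<le> Suc e \<Longrightarrow> d b \<in> B" for d i k r
  proof -
    have \<eta>: "fps_nth (taylor i y - fps_const y) j \<in> B" for j
      using y(1)[of j i] B(1) by (cases j) (auto simp: is_subring_def)
    have "fps_nth (taylor i (d b) * (taylor i y - fps_const y) ^ (b - r)) k \<in> B" if "b \<le> Suc e" for b
      using that \<open>\<And>b. b \<le> Suc e \<Longrightarrow> d b \<in> B\<close> stable \<eta>
      by (intro is_subring_fps_nth_mult[OF B(1)] is_subring_fps_nth_power[OF B(1)]) auto
    then show ?thesis
      unfolding d'_def using B(1) is_subring_of_nat[OF B(1)]
      by (intro is_subring_sum[OF B(1)]) (auto simp: is_subring_def)
  qed
  have d'_rel: "(\<Sum>r\<le>Suc e. d' d i k r * y ^ r) = 0" if "(\<Sum>b\<le>Suc e. d b * y ^ b) = 0" for d i k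
    using arg_cong[OF that, of "hasse i k"] unfolding hasse_power_sum d'_def
    using hasse_const_mult[of i k 0 0] by simp
  have d'_top: "d' d i k (Suc e) = hasse i k (d (Suc e))" for d i k
    unfolding d'_def by (simp add: binomial_eq_0)
  have "d (Suc e) = 0" if "\<And>b. b \<le> Suc e \<Longrightarrow> d b \<in> B" "(\<Sum>b\<le>Suc e. d b * y ^ b) = 0"
    "\<And>u. gs_coeff (d (Suc e)) u \<noteq> 0 \<Longrightarrow> mdeg u < D" for D d
    using that
  proof (induction D arbitrary: d)
    case 0
    then show ?case by (intro gseries_eqI) (auto simp: zero_gseries.rep_eq)
  next
    case (Suc D)
    have hasse_top: "hasse i k (d (Suc e)) = 0" if "k > 0" for i k
    proof -
      have "d' d i k (Suc e) = 0"
      proof (rule Suc.IH[of "d' d i k"])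
        fix u assume "gs_coeff (d' d i k (Suc e)) u \<noteq> 0"
        then have "gs_coeff (d (Suc e)) (u + Poly_Mapping.single i k) \<noteq> 0"
          by (auto simp: d'_top hasse.rep_eq)
        from Suc.prems(3)[OF this] show "mdeg u < D"
          using that by (simp add: mdeg_add)
      next
        show "d' d i k b \<in> B" for b
          by (rule d'_in) (rule Suc.prems(1))
        show "(\<Sum>b\<le>Suc e. d' d i k b * y ^ b) = 0"
          by (rule d'_rel) (rule Suc.prems(2))
      qed
      then show ?thesis by (simp add: d'_top)
    qed
    have "d (Suc e) = const_gseries (gs_coeff (d (Suc e)) 0)"
      by (rule const_if_hasse_eq_0) (rule hasse_top)
    then obtain c where c: "d (Suc e) = const_gseries c" ..
    define c' where "c' = of_nat (Suc e) * c"
    \<comment> \<open>The next coefficient of the derived relation, which now has order at most \<open>e\<close>, vanishes.\<close>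
    have "hasse i k (d e + const_gseries c' * y) = 0" if k: "k > 0" for i k
    proof -
      have rel': "(\<Sum>r\<le>e. d' d i k r * y ^ r) = 0"
        using d'_rel[OF Suc.prems(2), of i k] by (simp add: d'_top hasse_top[OF k])
      have "\<forall>r\<le>e. d' d i k r = 0"
      proof (rule outer_IH[of "d' d i k"])
        show "d' d i k b \<in> B" for b
          by (rule d'_in) (rule Suc.prems(1))
      qed (use Suc_prems_e rel' in simp_all)
      then have "d' d i k e = 0" by simp
      moreover have "d' d i k e = hasse i k (d e) + const_gseries c' * hasse i k y"
      proof -
        have "(\<Sum>b\<le>e. of_nat (b choose e) * fps_nth (taylor i (d b) * (taylor i y - fps_const y) ^ (b - e)) k)
            = (\<Sum>b\<in>{e}. hasse i k (d b))"
          by (intro sum.mono_neutral_cong_right) (auto simp: binomial_eq_0)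
        then show ?thesis
          using k by (simp add: d'_def c taylor_const c'_def const_gseries_mult const_gseries_add
              const_gseries_of_nat algebra_simps)
      qed
      ultimately show ?thesis
        by (simp add: hasse_add hasse_const_mult)
    qed
    then have "d e + const_gseries c' * y = const_gseries (gs_coeff (d e + const_gseries c' * y) 0)"
      by (rule const_if_hasse_eq_0)
    then obtain c'' where "d e + const_gseries c' * y = const_gseries c''" ..
    then have eq: "const_gseries c' * y = const_gseries c'' + - d e"
      by (simp add: algebra_simps)
    have "const_gseries c'' \<in> B" "- d e \<in> B"
      using Suc.prems(1)[of e] B by (auto simp: is_subring_def)
    then have *: "const_gseries c' * y \<in> B"
      unfolding eq using B(1) unfolding is_subring_def by blast
    have "c = 0"
    proof (rule ccontr)
      assume "c \<noteq> 0"
      then have "c' \<noteq> 0"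
        using Suc_prems_e[of "Suc e"] by (simp add: c'_def)
      then have "y = const_gseries (inverse c') * (const_gseries c' * y)"
        by (simp flip: mult.assoc const_gseries_mult)
      also have "const_gseries (inverse c') \<in> B"
        using B(2) by blast
      then have "const_gseries (inverse c') * (const_gseries c' * y) \<in> B"
        using * B(1) unfolding is_subring_def by blast
      finally show False using y(2) by simp
    qed
    then show ?case by (simp add: c)
  qed
  moreover obtain D where "\<And>u. gs_coeff (d (Suc e)) u \<noteq> 0 \<Longrightarrow> mdeg u < D"
    using gs_coeff[of "d (Suc e)"] less_Suc_eq_le by blast
  ultimately have top: "d (Suc e) = 0"
    using Suc.prems by blast
  then have "\<forall>b\<le>e. d b = 0"
    using Suc.prems by (intro Suc.IH) auto
  with top show ?case
    by (auto simp: le_Suc_eq)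
qed

section \<open>Minimal generators of a Hasse-stable graded subalgebra\<close>

text \<open>
  These are the properties of the ring of bounded elements on which the argument rests: it is a graded
  \<open>K\<close>-subalgebra of the ring of all series, stable under the Hasse derivatives.
\<close>

locale hasse_subalgebra =
  fixes R :: "('u, 'k::field) gseries set"
  assumes subring: "is_subring R"
    and const_in: "const_gseries c \<in> R"
    and hom_part_in: "f \<in> R \<Longrightarrow> hom_part n f \<in> R"
    and hasse_in: "f \<in> R \<Longrightarrow> hasse i k f \<in> R"
begin

definition pos_elements :: "('u, 'k) gseries set" where
  "pos_elements = (\<Union>d\<in>{0<..}. R \<inter> homogeneous d)"

definition decomposables :: "('u, 'k) gseries set" where
  "decomposables = {f * g | f g. f \<in> pos_elements \<and> g \<in> pos_elements}"

text \<open>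
  Equivalently, \<open>X\<close> maps bijectively onto a homogeneous basis of \<open>R\<^sub>+ / R\<^sub>+\<^sup>2\<close>, where \<open>R\<^sub>+\<close> is the ideal of
  elements without constant term.
\<close>

definition minimal_generators :: "('u, 'k) gseries set \<Rightarrow> bool" where
  "minimal_generators X \<longleftrightarrow> X \<subseteq> pos_elements \<and> pos_elements \<subseteq> gs.span (X \<union> decomposables) \<and>
     (\<forall>x\<in>X. x \<notin> gs.span ((X - {x}) \<union> decomposables))"

lemma decomposables_subset: "decomposables \<subseteq> pos_elements"
proof
  fix h assume "h \<in> decomposables"
  then obtain f g a b where h: "h = f * g" "f \<in> R" "g \<in> R" "f \<in> homogeneous a" "g \<in> homogeneous b" "a > 0" "b > 0"
    by (auto simp: decomposables_def pos_elements_def)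
  then have "h \<in> homogeneous (a + b)" "h \<in> R" "a + b > 0"
    using subring by (auto simp: homogeneous_mult is_subring_def)
  then show "h \<in> pos_elements"
    by (auto simp: pos_elements_def)
qed

text \<open>
  Extend a basis of the span of the decomposable elements to a basis of the span of all homogeneous
  elements of positive degree; the added vectors are minimal generators.
\<close>

lemma minimal_generators_exist: "\<exists>X. minimal_generators X"
proof -
  obtain S where S: "S \<subseteq> decomposables" "gs.independent S" "decomposables \<subseteq> gs.span S"
    by (rule gs.maximal_independent_subset)
  have "S \<subseteq> pos_elements"
    using S(1) decomposables_subset by (rule order_trans)
  then obtain T where T: "S \<subseteq> T" "T \<subseteq> pos_elements" "gs.independent T" "pos_elements \<subseteq> gs.span T"
    using S(2) by (rule gs.maximal_independent_subset_extend)
  define X where "X = T - S"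
  have "T \<subseteq> X \<union> decomposables"
    using S(1) by (auto simp: X_def)
  then have "pos_elements \<subseteq> gs.span (X \<union> decomposables)"
    using T(4) gs.span_mono by blast
  moreover have "x \<notin> gs.span ((X - {x}) \<union> decomposables)" if "x \<in> X" for x
  proof
    assume x: "x \<in> gs.span ((X - {x}) \<union> decomposables)"
    have "S \<subseteq> T - {x}"
      using that T(1) by (auto simp: X_def)
    then have "decomposables \<subseteq> gs.span (T - {x})"
      using S(3) gs.span_mono by blast
    moreover have "X - {x} \<subseteq> gs.span (T - {x})"
      by (auto simp: X_def intro: gs.span_base)
    ultimately have "gs.span ((X - {x}) \<union> decomposables) \<subseteq> gs.span (T - {x})"
      by (intro gs.span_minimal) auto
    then show False
      using x T(3) that by (auto simp: X_def gs.dependent_def)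
  qed
  ultimately have "minimal_generators X"
    using T(2) by (auto simp: minimal_generators_def X_def)
  then show ?thesis ..
qed

lemma minimal_generatorsE:
  assumes "minimal_generators X" "x \<in> X"
  obtains d where "x \<in> R" "x \<in> homogeneous d" "d > 0"
proof -
  have "x \<in> pos_elements"
    using assms by (auto simp: minimal_generators_def)
  then show ?thesis
    using that by (auto simp: pos_elements_def)
qed

definition below :: "('u, 'k) gseries set \<Rightarrow> nat \<Rightarrow> ('u, 'k) gseries set" where
  "below X n = {x \<in> X. \<exists>d<n. x \<in> homogeneous d}"

lemma below_mono: "m \<le> n \<Longrightarrow> below X m \<subseteq> below X n"
  by (force simp: below_def)

text \<open>
  Modulo linear combinations of generators, an element of degree \<open>m\<close> is a sum of products of
  elements of degree less than \<open>m\<close>, to which induction applies.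
\<close>

lemma homogeneous_in_gen_alg:
  assumes X: "minimal_generators X" and f: "f \<in> R" "f \<in> homogeneous m"
  shows "f \<in> gen_alg (below X (Suc m))"
  using f
proof (induction m arbitrary: f rule: less_induct)
  case (less m)
  show ?case
  proof (cases "m = 0")
    case True
    then have "f = const_gseries (gs_coeff f 0)"
      using less.prems(2) hom_part_0[of f] by (simp add: hom_part_homogeneous)
    then show ?thesis
      by (metis gen_alg.const)
  next
    case False
    let ?B = "gen_alg (below X (Suc m))" and ?T = "{g. hom_part m g \<in> gen_alg (below X (Suc m))}"
    have 0: "0 \<in> ?B"
      using gen_alg.const[of 0] by simp
    have "X \<union> decomposables \<subseteq> ?T"
    proof (rule Un_least; rule subsetI)
      fix x assume x: "x \<in> X"
      then obtain d where d: "x \<in> homogeneous d"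
        using minimal_generatorsE[OF X] by blast
      show "x \<in> ?T"
      proof (cases "d = m")
        case True
        then have "x \<in> below X (Suc m)"
          using x d by (auto simp: below_def)
        then show ?thesis
          using d True by (simp add: hom_part_homogeneous gen_alg.gen)
      qed (use d 0 in \<open>simp add: hom_part_homogeneous\<close>)
    next
      fix h assume "h \<in> decomposables"
      then obtain f g a b where h: "h = f * g" "f \<in> R" "g \<in> R" "f \<in> homogeneous a"
        "g \<in> homogeneous b" "a > 0" "b > 0"
        by (auto simp: decomposables_def pos_elements_def)
      then have hom: "h \<in> homogeneous (a + b)"
        by (simp add: homogeneous_mult)
      show "h \<in> ?T"
      proof (cases "m = a + b")
        case True
        have "f \<in> gen_alg (below X (Suc a))" "g \<in> gen_alg (below X (Suc b))"
          using h True by (auto intro: less.IH)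
        moreover have "below X (Suc a) \<subseteq> below X (Suc m)" "below X (Suc b) \<subseteq> below X (Suc m)"
          using True by (auto intro!: below_mono)
        ultimately have "f \<in> ?B" "g \<in> ?B"
          using gen_alg_mono by blast+
        then show ?thesis
          using hom h(1) True by (simp add: hom_part_homogeneous gen_alg.mult)
      qed (use hom 0 in \<open>simp add: hom_part_homogeneous\<close>)
    qed
    moreover have "gs.subspace ?T"
    proof (rule gs.subspaceI)
      show "0 \<in> ?T"
        using 0 hom_part_const_mult[of m 0 "0 :: ('u, 'k) gseries"] by simp
    qed (auto simp: hom_part_add hom_part_const_mult intro: gen_alg.intros)
    ultimately have "gs.span (X \<union> decomposables) \<subseteq> ?T"
      by (rule gs.span_minimal)
    moreover have "f \<in> pos_elements"
      using less.prems False by (auto simp: pos_elements_def)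
    ultimately have "f \<in> ?T"
      using X by (auto simp: minimal_generators_def)
    then show ?thesis
      using less.prems(2) by (simp add: hom_part_homogeneous)
  qed
qed

lemma hasse_generator:
  assumes X: "minimal_generators X" and y: "y \<in> X" "y \<in> homogeneous d" and k: "k > 0"
  shows "hasse i k y \<in> gen_alg (below X d)"
proof (cases "d < k")
  case True
  then show ?thesis
    using hasse_eq_0_if_degree_less[OF y(2), of k i] gen_alg.const[of 0 "below X d"] by simp
next
  case False
  have "y \<in> R"
    using X y(1) by (auto simp: minimal_generators_def pos_elements_def)
  then have "hasse i k y \<in> gen_alg (below X (Suc (d - k)))"
    using homogeneous_in_gen_alg[OF X hasse_in hasse_homogeneous[OF y(2)]] by simp
  moreover have "below X (Suc (d - k)) \<subseteq> below X d"
    using False k by (intro below_mono) simp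
  ultimately show ?thesis
    using gen_alg_mono by blast
qed

text \<open>
  A proper Hasse derivative of a generator has smaller degree, hence is a polynomial in generators of
  smaller degree. So \<open>G\<close> only has to be closed under passing to generators of smaller degree. The Hasse
  derivatives of \<open>p\<close>-th powers take care of themselves by \<open>hasse_power_CHAR\<close>.
\<close>

lemma hasse_stable:
  assumes X: "minimal_generators X" and p: "p = CHAR('k)"
    and G: "G \<subseteq> X" "\<And>x d. x \<in> G \<Longrightarrow> x \<in> homogeneous d \<Longrightarrow> below X d \<subseteq> G"
    and f: "f \<in> gen_alg (G \<union> (\<lambda>x. x ^ p) ` X)"
  shows "hasse i k f \<in> gen_alg (G \<union> (\<lambda>x. x ^ p) ` X)"
  using _ f
proof (rule hasse_in_gen_alg)
  fix g k assume "g \<in> G \<union> (\<lambda>x. x ^ p) ` X"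
  then consider "g \<in> G" | x where "x \<in> X" "g = x ^ p"
    by blast
  then show "hasse i k g \<in> gen_alg (G \<union> (\<lambda>x. x ^ p) ` X)"
  proof cases
    case 1
    show ?thesis
    proof (cases "k = 0")
      case True
      then show ?thesis using 1 by (simp add: gen_alg.gen)
    next
      case False
      have "g \<in> X" using 1 G(1) by blast
      then obtain d where d: "g \<in> homogeneous d"
        using minimal_generatorsE[OF X] by blast
      have "below X d \<subseteq> G \<union> (\<lambda>x. x ^ p) ` X"
        using G(2)[OF 1 d] by blast
      then show ?thesis
        using hasse_generator[OF X \<open>g \<in> X\<close> d, of k i] False gen_alg_mono by blast
    qed
  next
    case 2
    then obtain d where d: "x \<in> R" "x \<in> homogeneous d"
      using minimal_generatorsE[OF X] by blast
    have "hasse i j x \<in> gen_alg X" for j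
    proof -
      have "below X (Suc (d - j)) \<subseteq> X"
        by (auto simp: below_def)
      then show ?thesis
        using homogeneous_in_gen_alg[OF X hasse_in[OF d(1)] hasse_homogeneous[OF d(2)]] gen_alg_mono
        by blast
    qed
    then have "hasse i k g \<in> gen_alg ((\<lambda>x. x ^ p) ` X)"
      unfolding 2(2) by (rule hasse_power_CHAR[OF p])
    then show ?thesis
      using gen_alg_mono[of "(\<lambda>x. x ^ p) ` X" "G \<union> (\<lambda>x. x ^ p) ` X"] by blast
  qed
qed

text \<open>
  If \<open>n\<close> is the degree of \<open>y\<close>, the elements whose degree \<open>n\<close> part is a combination of the other generators
  and of decomposable elements form a subalgebra: in degree \<open>n\<close>, a product of two such elements
  consists of constant multiples of their degree \<open>n\<close> parts and of decomposable terms. This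
  subalgebra contains the other generators and all \<open>p\<close>-th powers, but not \<open>y\<close>.
\<close>

lemma generator_not_in_gen_alg:
  assumes X: "minimal_generators X" and p: "p = CHAR('k)" and G: "G \<subseteq> X"
    and y: "y \<in> X" "y \<notin> G"
  shows "y \<notin> gen_alg (G \<union> (\<lambda>x. x ^ p) ` X)"
proof
  obtain n where n: "y \<in> homogeneous n" "n > 0"
    using minimal_generatorsE[OF X y(1)] by blast
  define S where "S = gs.span ((X - {y}) \<union> decomposables)"
  have S0: "0 \<in> S"
    unfolding S_def by (rule gs.span_zero)
  have base: "hom_part n h \<in> S" if h: "h \<in> (X - {y}) \<union> decomposables" for h
  proof -
    have "h \<in> pos_elements"
      using h X decomposables_subset by (auto simp: minimal_generators_def)
    then obtain m where "h \<in> homogeneous m"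
      by (auto simp: pos_elements_def)
    moreover have "h \<in> S"
      using h unfolding S_def by (rule gs.span_base)
    ultimately show ?thesis
      using S0 by (simp add: hom_part_homogeneous)
  qed
  have const_S: "hom_part n (const_gseries c) \<in> S" for c
  proof -
    have "(const_gseries c :: ('u, 'k) gseries) \<in> homogeneous 0"
      by (simp add: homogeneous_def const_gseries.rep_eq)
    then show ?thesis
      using n(2) S0 by (simp add: hom_part_homogeneous)
  qed
  have pos_mult: "f * g \<in> pos_elements" if "f \<in> pos_elements" "g \<in> pos_elements" for f g
    using that decomposables_subset by (auto simp: decomposables_def)
  have pos_power: "x ^ Suc m \<in> pos_elements" if "x \<in> pos_elements" for x m
    using that by (induction m) (simp_all add: pos_mult)
  have "f \<in> R \<and> hom_part n f \<in> S" if "f \<in> gen_alg (G \<union> (\<lambda>x. x ^ p) ` X)" for f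
    using that
  proof induction
    case (const c)
    show ?case using const_S const_in by simp
  next
    case (gen g)
    then consider "g \<in> G" | x where "x \<in> X" "g = x ^ p"
      by blast
    then show ?case
    proof cases
      case 1
      then have "g \<in> X - {y}"
        using G y(2) by blast
      then show ?thesis
        using base[of g] X by (auto simp: minimal_generators_def pos_elements_def)
    next
      case 2
      show ?thesis
      proof (cases "p = 0")
        case True
        then show ?thesis using 2 const_S[of 1] const_in[of 1] by simp
      next
        case False
        \<comment> \<open>As \<open>p \<ge> 2\<close>, a \<open>p\<close>-th power is a product of two elements of positive degree.\<close>
        then have "p - 2 + 2 = p"
          using CHAR_not_1'[where 'a='k] p by linarith
        then have "g = x * x ^ Suc (p - 2)"
          using 2(2) by (simp flip: power_Suc)
        moreover have "x \<in> pos_elements"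
          using 2(1) X by (auto simp: minimal_generators_def)
        ultimately have g: "g \<in> decomposables"
          using pos_power unfolding decomposables_def by blast
        then have "g \<in> R"
          using decomposables_subset by (auto simp: pos_elements_def)
        then show ?thesis
          using g base[of g] by simp
      qed
    qed
  next
    case (add f g)
    then show ?case
      using subring by (auto simp: is_subring_def hom_part_add S_def intro: gs.span_add)
  next
    case (mult f g)
    have "hom_part j f * hom_part (n - j) g \<in> S" if "j \<le> n" for j
    proof -
      consider "j = 0" | "j = n" | "0 < j" "0 < n - j"
        using \<open>j \<le> n\<close> by linarith
      then show ?thesis
      proof cases
        case 1
        then show ?thesis
          using mult.IH unfolding S_def by (auto simp: hom_part_0 intro: gs.span_scale)
      next
        case 2
        then show ?thesis
          using mult.IH unfolding S_def
          by (auto simp: hom_part_0 mult.commute[of _ "const_gseries _"] intro: gs.span_scale)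
      next
        case 3
        then have "hom_part j f \<in> pos_elements" "hom_part (n - j) g \<in> pos_elements"
          using mult.IH hom_part_in hom_part_in_homogeneous unfolding pos_elements_def by blast+
        then have "hom_part j f * hom_part (n - j) g \<in> decomposables"
          by (auto simp: decomposables_def)
        then show ?thesis
          unfolding S_def by (intro gs.span_base) simp
      qed
    qed
    then have "hom_part n (f * g) \<in> S"
      unfolding hom_part_mult S_def by (intro gs.span_sum) simp
    then show ?case
      using mult.IH subring by (simp add: is_subring_def)
  qed
  moreover assume "y \<in> gen_alg (G \<union> (\<lambda>x. x ^ p) ` X)"
  ultimately have "hom_part n y \<in> S"
    by blast
  then have "y \<in> S"
    using n(1) by (simp add: hom_part_homogeneous)
  then show False
    using X y(1) by (auto simp: minimal_generators_def S_def)
qed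

section \<open>Linear independence of monomials\<close>

text \<open>
  The variables are added in order of increasing degree. When \<open>y\<close> is added to \<open>F\<close>, a relation is sorted by
  powers of \<open>y\<close>; its coefficients lie in the subalgebra generated by \<open>F\<close>, all generators of smaller
  degree and all \<open>p\<close>-th powers, over which the powers of \<open>y\<close> with exponent below \<open>p\<close> are independent.
\<close>

lemma reduced_monomials_independent:
  fixes c :: "(('u, 'k) gseries \<Rightarrow> nat) \<Rightarrow> ('u, 'k) gseries"
  assumes X: "minimal_generators X" and p: "p = CHAR('k)"
    and F: "finite F" "F \<subseteq> X" and M: "finite M"
    and supp: "\<And>\<beta> x. \<beta> \<in> M \<Longrightarrow> x \<notin> F \<Longrightarrow> \<beta> x = 0"
    and reduced: "\<And>\<beta> x. \<beta> \<in> M \<Longrightarrow> x \<in> F \<Longrightarrow> p = 0 \<or> \<beta> x < p"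
    and c: "\<And>\<beta>. \<beta> \<in> M \<Longrightarrow> c \<beta> \<in> gen_alg ((\<lambda>x. x ^ p) ` X)"
    and rel: "(\<Sum>\<beta>\<in>M. c \<beta> * (\<Prod>x\<in>F. x ^ \<beta> x)) = 0"
  shows "\<forall>\<beta>\<in>M. c \<beta> = 0"
proof -
  define deg where "deg x = (SOME d. x \<in> homogeneous d)" for x :: "('u, 'k) gseries"
  have deg: "x \<in> homogeneous (deg x)" if "x \<in> X" for x
  proof -
    have "\<exists>d. x \<in> homogeneous d"
      using that minimal_generatorsE[OF X] by blast
    then show ?thesis
      unfolding deg_def by (rule someI_ex)
  qed
  have deg_eq: "d = deg x" if "x \<in> X" "x \<in> homogeneous d" for x d
  proof -
    have "x \<noteq> 0"
      using that(1) X by (auto simp: minimal_generators_def gs.span_zero)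
    then show ?thesis
      using homogeneous_unique_degree deg[OF that(1)] that(2) by blast
  qed
  show ?thesis
    using F M supp reduced c rel
  proof (induction F arbitrary: M c rule: finite_ranking_induct[where f = deg])
    case empty
    show ?case
    proof
      fix \<beta> assume \<beta>: "\<beta> \<in> M"
      have "M \<subseteq> {\<lambda>_. 0}"
        using empty.prems(3) by blast
      then have "M = {\<beta>}"
        using \<beta> by blast
      then show "c \<beta> = 0"
        using empty.prems(6) by simp
    qed
  next
    case (insert y F)
    show ?case
    proof (cases "y \<in> F")
      case True
      then show ?thesis
        using insert.IH[of M c] insert.prems by (simp add: insert_absorb)
    next
      case False
      define G where "G = below X (deg y) \<union> F"
      define B where "B = gen_alg (G \<union> (\<lambda>x. x ^ p) ` X)"
      have y: "y \<in> X" and FX: "F \<subseteq> X"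
        using insert.prems(1) by auto
      have GX: "G \<subseteq> X"
        using FX by (auto simp: G_def below_def)
      have G_le: "deg x \<le> deg y" if "x \<in> G" for x
        using that insert.hyps deg_eq by (auto simp: G_def below_def) 
      have yG: "y \<notin> G"
        using False deg_eq[OF y] by (auto simp: G_def below_def)
      have below_G: "below X d \<subseteq> G" if "x \<in> G" "x \<in> homogeneous d" for x d
      proof -
        have "d \<le> deg y"
          using that G_le GX deg_eq by blast
        then have "below X d \<subseteq> below X (deg y)"
          by (rule below_mono)
        then show ?thesis
          by (auto simp: G_def)
      qed
      have G_B: "gen_alg H \<subseteq> B" if "H \<subseteq> G \<union> (\<lambda>x. x ^ p) ` X" for H
        unfolding B_def using that by (rule gen_alg_mono)
      define d where "d b = (\<Sum>\<beta>\<in>{\<beta>\<in>M. \<beta> y = b}. c \<beta> * (\<Prod>x\<in>F. x ^ \<beta> x))" for b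
      \<comment> \<open>Inserting \<open>0\<close> covers empty \<open>M\<close>.\<close>
      define e where "e = Max (insert 0 ((\<lambda>\<beta>. \<beta> y) ` M))"
      have e: "\<beta> y \<le> e" if "\<beta> \<in> M" for \<beta>
        unfolding e_def using that insert.prems(2) by (intro Max_ge) auto
      have e_mem: "e = 0 \<or> (\<exists>\<beta>\<in>M. e = \<beta> y)"
        using Max_in[of "insert 0 ((\<lambda>\<beta>. \<beta> y) ` M)"] insert.prems(2) by (auto simp: e_def)
      have d_0: "\<forall>b\<le>e. d b = 0"
      proof (rule powers_independent_over_hasse_stable)
        show "is_subring B"
          unfolding B_def by (rule is_subring_gen_alg)
        show "range const_gseries \<subseteq> B"
          unfolding B_def by (auto intro: gen_alg.const)
        show "hasse i k f \<in> B" if "f \<in> B" for i k f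
          using that unfolding B_def by (intro hasse_stable[OF X p GX below_G])
        show "hasse i k y \<in> B" if "k > 0" for i k
          using hasse_generator[OF X y deg[OF y] that] G_B[of "below X (deg y)"]
          by (auto simp: G_def)
        show "y \<notin> B"
          unfolding B_def by (rule generator_not_in_gen_alg[OF X p GX y yG])
        show "of_nat b \<noteq> (0 :: 'k)" if b: "0 < b" "b \<le> e" for b
        proof
          assume "of_nat b = (0 :: 'k)"
          then have "p dvd b"
            by (simp add: p of_nat_eq_0_iff_char_dvd)
          then have "p \<le> e" "p \<noteq> 0"
            using b by (auto dest: dvd_imp_le)
          moreover have "e < p"
            using e_mem insert.prems(4)[of _ y] \<open>p \<noteq> 0\<close> by auto
          ultimately show False by simp
        qed
        show "d b \<in> B" for b
          unfolding d_def
        proof (rule is_subring_sum[OF \<open>is_subring B\<close>])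
          fix \<beta> assume "\<beta> \<in> {\<beta> \<in> M. \<beta> y = b}"
          then have "c \<beta> \<in> B"
            using insert.prems(5) G_B[of "(\<lambda>x. x ^ p) ` X"] by blast
          moreover have "(\<Prod>x\<in>F. x ^ \<beta> x) \<in> B"
            unfolding B_def by (intro gen_alg_prod gen_alg_power gen_alg.gen) (simp add: G_def)
          ultimately show "c \<beta> * (\<Prod>x\<in>F. x ^ \<beta> x) \<in> B"
            unfolding B_def by (rule gen_alg.mult)
        qed
        have "(\<Sum>b\<le>e. d b * y ^ b) =
            (\<Sum>b\<le>e. \<Sum>\<beta>\<in>{\<beta>\<in>M. \<beta> y = b}. c \<beta> * (\<Prod>x\<in>insert y F. x ^ \<beta> x))"
          unfolding d_def using False insert.hyps(1)
          by (intro sum.cong) (simp_all add: sum_distrib_left mult_ac)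
        also have "\<dots> = (\<Sum>\<beta>\<in>M. c \<beta> * (\<Prod>x\<in>insert y F. x ^ \<beta> x))"
          using e insert.prems(2) by (intro sum.group) auto
        finally show "(\<Sum>b\<le>e. d b * y ^ b) = 0"
          using insert.prems(6) by simp
      qed
      show ?thesis
      proof
        fix \<beta> assume \<beta>: "\<beta> \<in> M"
        define b where "b = \<beta> y"
        \<comment> \<open>The monomials with a fixed exponent at \<open>y\<close> correspond to monomials in \<open>F\<close>, with inverse \<open>?s\<close>.\<close>
        let ?M = "{\<beta>\<in>M. \<beta> y = b}" and ?z = "\<lambda>\<beta>. \<beta>(y := 0)" and ?s = "\<lambda>\<beta>. \<beta>(y := b)"
        have sz: "?s (?z \<gamma>) = \<gamma>" if "\<gamma> \<in> ?M" for \<gamma>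
          using that by auto
        have "\<forall>\<gamma>\<in>?z ` ?M. c (?s \<gamma>) = 0"
        proof (rule insert.IH)
          show "finite (?z ` ?M)"
            using insert.prems(2) by simp
          show "\<gamma> x = 0" if "\<gamma> \<in> ?z ` ?M" "x \<notin> F" for \<gamma> x
            using that insert.prems(3) by auto
          show "p = 0 \<or> \<gamma> x < p" if \<gamma>: "\<gamma> \<in> ?z ` ?M" and x: "x \<in> F" for \<gamma> x
          proof -
            obtain \<delta> where "\<delta> \<in> M" "\<gamma> = ?z \<delta>"
              using \<gamma> by blast
            then show ?thesis
              using x False insert.prems(4)[of \<delta> x] by auto
          qed
          show "c (?s \<gamma>) \<in> gen_alg ((\<lambda>x. x ^ p) ` X)" if "\<gamma> \<in> ?z ` ?M" for \<gamma>
            using that insert.prems(5) sz by auto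
          have "(\<Sum>\<gamma>\<in>?z ` ?M. c (?s \<gamma>) * (\<Prod>x\<in>F. x ^ \<gamma> x)) = d b"
            unfolding d_def
          proof (rule sum.reindex_cong)
            show "inj_on ?z ?M"
              by (rule inj_on_inverseI[of _ ?s]) (rule sz)
            fix \<gamma> assume "\<gamma> \<in> ?M"
            moreover have "(\<Prod>x\<in>F. x ^ (?z \<gamma>) x) = (\<Prod>x\<in>F. x ^ \<gamma> x)"
              using False by (intro prod.cong) auto
            ultimately show "c (?s (?z \<gamma>)) * (\<Prod>x\<in>F. x ^ (?z \<gamma>) x) = c \<gamma> * (\<Prod>x\<in>F. x ^ \<gamma> x)"
              using sz by simp
          qed simp
          also have "d b = 0"
            using d_0 e[OF \<beta>] by (simp add: b_def)
          finally show "(\<Sum>\<gamma>\<in>?z ` ?M. c (?s \<gamma>) * (\<Prod>x\<in>F. x ^ \<gamma> x)) = 0" .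
        qed (rule FX)
        then have "c (?s (?z \<beta>)) = 0"
          using \<beta> by (auto simp: b_def)
        then show "c \<beta> = 0"
          by (simp add: b_def)
      qed
    qed
  qed
qed

text \<open>
  Divide each exponent by \<open>p\<close> with remainder. Independence of the reduced monomials over the algebra of
  \<open>p\<close>-th powers splits a relation into one relation for each tuple \<open>\<rho>\<close> of remainders, among
  the \<open>p\<close>-th powers of the monomials formed by the quotients. Frobenius preserves independence, and
  the quotients have smaller total exponent unless all exponents are \<open>0\<close>, so induction applies. In characteristic \<open>0\<close>, division
  by \<open>p = 0\<close> leaves the remainder equal to the exponent, and each of the split relations has a single term.
\<close>

lemma monomials_independent:
  assumes X: "minimal_generators X" and F: "finite F" "F \<subseteq> X" and M: "finite M"
    and supp: "\<And>\<beta> x. \<beta> \<in> M \<Longrightarrow> x \<notin> F \<Longrightarrow> \<beta> x = 0"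
    and rel: "(\<Sum>\<beta>\<in>M. const_gseries (a \<beta>) * (\<Prod>x\<in>F. x ^ \<beta> x)) = 0"
  shows "\<forall>\<beta>\<in>M. a \<beta> = 0"
proof -
  define p where "p = CHAR('k)"
  define mon where "mon \<beta> = (\<Prod>x\<in>F. x ^ \<beta> x)" for \<beta> :: "('u, 'k) gseries \<Rightarrow> nat"
  define q where "q \<beta> = (\<lambda>x. \<beta> x div p)" for \<beta> :: "('u, 'k) gseries \<Rightarrow> nat"
  define r where "r \<beta> = (\<lambda>x. \<beta> x mod p)" for \<beta> :: "('u, 'k) gseries \<Rightarrow> nat"
  have mon_split: "mon \<beta> = mon (q \<beta>) ^ p * mon (r \<beta>)" for \<beta>
    by (simp add: mon_def q_def r_def prod_power_distrib flip: prod.distrib power_mult power_add)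
  have split_rel: "(\<Sum>\<beta>\<in>{\<beta>\<in>M. r \<beta> = \<rho>}. const_gseries (a \<beta>) * mon (q \<beta>) ^ p) = 0"
    if M: "finite M" "\<And>\<beta> x. \<beta> \<in> M \<Longrightarrow> x \<notin> F \<Longrightarrow> \<beta> x = 0"
      and rel: "(\<Sum>\<beta>\<in>M. const_gseries (a \<beta>) * mon \<beta>) = 0" and \<rho>: "\<rho> \<in> r ` M" for M a \<rho>
  proof -
    define c where "c \<rho> = (\<Sum>\<beta>\<in>{\<beta>\<in>M. r \<beta> = \<rho>}. const_gseries (a \<beta>) * mon (q \<beta>) ^ p)" for \<rho>
    have "\<forall>\<rho>\<in>r ` M. c \<rho> = 0"
    proof (rule reduced_monomials_independent[OF X p_def F])
      show "finite (r ` M)"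
        using M(1) by simp
      show "\<rho> x = 0" if \<rho>: "\<rho> \<in> r ` M" and x: "x \<notin> F" for \<rho> x
      proof -
        obtain \<beta> where "\<beta> \<in> M" "\<rho> = r \<beta>"
          using \<rho> by blast
        then show ?thesis
          using M(2)[of \<beta> x] x by (simp add: r_def)
      qed
      show "p = 0 \<or> \<rho> x < p" if "\<rho> \<in> r ` M" for \<rho> x
        using that by (cases "p = 0") (auto simp: r_def)
      show "c \<rho> \<in> gen_alg ((\<lambda>x. x ^ p) ` X)" for \<rho>
      proof -
        have "mon (q \<beta>) ^ p = (\<Prod>x\<in>F. (x ^ p) ^ q \<beta> x)" for \<beta>
          by (simp add: mon_def prod_power_distrib mult.commute flip: power_mult)
        moreover have "(\<Prod>x\<in>F. (x ^ p) ^ q \<beta> x) \<in> gen_alg ((\<lambda>x. x ^ p) ` X)" for \<beta>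
          using F(2) by (intro gen_alg_prod gen_alg_power gen_alg.gen) auto
        ultimately show ?thesis
          unfolding c_def by (intro gen_alg_sum gen_alg.mult gen_alg.const) simp
      qed
      have "const_gseries (a \<beta>) * mon (q \<beta>) ^ p * mon \<rho> = const_gseries (a \<beta>) * mon \<beta>"
        if "r \<beta> = \<rho>" for \<beta> \<rho>
        unfolding that[symmetric] by (subst mon_split[of \<beta>]) (simp only: mult.assoc)
      then have "(\<Sum>\<rho>\<in>r ` M. c \<rho> * mon \<rho>) =
          (\<Sum>\<rho>\<in>r ` M. \<Sum>\<beta>\<in>{\<beta>\<in>M. r \<beta> = \<rho>}. const_gseries (a \<beta>) * mon \<beta>)"
        unfolding c_def sum_distrib_right by (intro sum.cong refl) simp
      also have "\<dots> = (\<Sum>\<beta>\<in>M. const_gseries (a \<beta>) * mon \<beta>)"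
        using M(1) by (intro sum.group) auto
      finally show "(\<Sum>\<rho>\<in>r ` M. c \<rho> * (\<Prod>x\<in>F. x ^ \<rho> x)) = 0"
        using rel by (simp add: mon_def)
    qed
    then have "c \<rho> = 0"
      using \<rho> by blast
    then show ?thesis
      by (simp add: c_def)
  qed
  have rel: "(\<Sum>\<beta>\<in>M. const_gseries (a \<beta>) * mon \<beta>) = 0"
    using rel by (simp add: mon_def)
  show ?thesis
  proof (cases "p = 0")
    case True
    show ?thesis
    proof
      fix \<beta> assume "\<beta> \<in> M"
      then have \<beta>: "{\<gamma>\<in>M. r \<gamma> = \<beta>} = {\<beta>}" "\<beta> \<in> r ` M"
        using True by (auto simp: r_def)
      have "(\<Sum>\<gamma>\<in>{\<gamma>\<in>M. r \<gamma> = \<beta>}. const_gseries (a \<gamma>) * mon (q \<gamma>) ^ p) = 0"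
        by (intro split_rel M supp rel \<beta>(2))
      then show "a \<beta> = 0"
        using True unfolding \<beta>(1) by simp
    qed
  next
    case False
    then have p: "p \<ge> 2"
      using CHAR_not_1'[where 'a='k] unfolding p_def by linarith
    have deg: "\<exists>N. \<forall>\<beta>\<in>M. sum \<beta> F \<le> N"
      using M by (intro exI[of _ "\<Sum>\<beta>\<in>M. sum \<beta> F"]) (auto intro: member_le_sum)
    have "\<forall>\<beta>\<in>M. a \<beta> = 0" if "finite M" "\<And>\<beta> x. \<beta> \<in> M \<Longrightarrow> x \<notin> F \<Longrightarrow> \<beta> x = 0"
      "\<forall>\<beta>\<in>M. sum \<beta> F \<le> N" "(\<Sum>\<beta>\<in>M. const_gseries (a \<beta>) * mon \<beta>) = 0" for N M a
      using that
    proof (induction N arbitrary: M a rule: less_induct)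
      case (less N)
      show ?case
      proof
        fix \<beta>0 assume \<beta>0: "\<beta>0 \<in> M"
        show "a \<beta>0 = 0"
        proof (cases "N = 0")
          case True
          have zero: "\<beta> = (\<lambda>_. 0)" if "\<beta> \<in> M" for \<beta>
          proof
            fix x show "\<beta> x = 0"
              using that less.prems(2)[of \<beta> x] less.prems(3) True F(1) by (cases "x \<in> F") auto
          qed
          have "M = {\<lambda>_. 0}" "\<beta>0 = (\<lambda>_. 0)"
            using zero \<beta>0 by blast+
          then show ?thesis
            using less.prems(4) by (simp add: mon_def)
        next
          case N: False
          define \<rho> where "\<rho> = r \<beta>0"
          let ?M = "{\<beta>\<in>M. r \<beta> = \<rho>}"
          \<comment> \<open>Recovers an exponent function with remainders \<open>\<rho>\<close> from its quotients.\<close>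
          let ?u = "\<lambda>\<gamma> x. \<gamma> x * p + \<rho> x"
          have u: "?u (q \<beta>) = \<beta>" if "\<beta> \<in> ?M" for \<beta>
            using that by (auto simp: q_def r_def)
          have "\<forall>\<beta>\<in>?M. a \<beta> = 0"
          proof (rule independent_power_CHAR[OF p_def])
            show "p > 0" "finite ?M"
              using False less.prems(1) by auto
            show "(\<Sum>\<beta>\<in>?M. const_gseries (a \<beta>) * mon (q \<beta>) ^ p) = 0"
              using \<beta>0 unfolding \<rho>_def by (intro split_rel less.prems) auto
            fix b assume b: "(\<Sum>\<beta>\<in>?M. const_gseries (b \<beta>) * mon (q \<beta>)) = 0"
            have "\<forall>\<gamma>\<in>q ` ?M. b (?u \<gamma>) = 0"
            proof (rule less.IH)
              show "N - 1 < N" "finite (q ` ?M)"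
                using N less.prems(1) by auto
              show "\<gamma> x = 0" if \<gamma>: "\<gamma> \<in> q ` ?M" and x: "x \<notin> F" for \<gamma> x
              proof -
                obtain \<beta> where "\<beta> \<in> M" "\<gamma> = q \<beta>"
                  using \<gamma> by blast
                then show ?thesis
                  using less.prems(2)[of \<beta> x] x by (simp add: q_def)
              qed
              show "\<forall>\<gamma>\<in>q ` ?M. sum \<gamma> F \<le> N - 1"
              proof
                fix \<gamma> assume "\<gamma> \<in> q ` ?M"
                then obtain \<beta> where \<beta>: "\<beta> \<in> M" "\<gamma> = q \<beta>" by blast
                have "sum \<gamma> F * 2 \<le> sum \<gamma> F * p"
                  using p by simp
                also have "\<dots> = (\<Sum>x\<in>F. \<gamma> x * p)"
                  by (rule sum_distrib_right)
                also have "\<dots> \<le> sum \<beta> F"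
                  by (rule sum_mono) (simp add: \<beta>(2) q_def)
                also have "\<dots> \<le> N"
                  using less.prems(3) \<beta>(1) by blast
                finally show "sum \<gamma> F \<le> N - 1"
                  using N by linarith
              qed
              have "(\<Sum>\<gamma>\<in>q ` ?M. const_gseries (b (?u \<gamma>)) * mon \<gamma>) =
                  (\<Sum>\<beta>\<in>?M. const_gseries (b \<beta>) * mon (q \<beta>))"
              proof (rule sum.reindex_cong)
                show "inj_on q ?M"
                  by (rule inj_on_inverseI[of _ ?u]) (rule u)
              qed (use u in auto)
              then show "(\<Sum>\<gamma>\<in>q ` ?M. const_gseries (b (?u \<gamma>)) * mon \<gamma>) = 0"
                using b by simp
            qed
            then show "\<forall>\<beta>\<in>?M. b \<beta> = 0"
              using u by force
          qed
          then show ?thesis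
            using \<beta>0 by (simp add: \<rho>_def)
        qed
      qed
    qed
    then show ?thesis
      using M supp rel deg by blast
  qed
qed

end

section \<open>Polynomials in minimal generators\<close>

text \<open>
  Applied to the set of monomials in \<open>X\<close>, this identifies the subalgebra generated by \<open>X\<close> with the
  linear span of the monomials.
\<close>

lemma span_mult_closed:
  fixes S :: "('u, 'k::field) gseries set"
  assumes S: "\<And>u v. u \<in> S \<Longrightarrow> v \<in> S \<Longrightarrow> u * v \<in> gs.span S"
    and f: "f \<in> gs.span S" and g: "g \<in> gs.span S"
  shows "f * g \<in> gs.span S"
proof -
  have *: "u * g \<in> gs.span S" if u: "u \<in> S" for u
    using g
  proof (induction rule: gs.span_induct_alt)
    case (step c x y)
    have "u * (const_gseries c * x + y) = const_gseries c * (u * x) + u * y"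
      by (simp add: algebra_simps)
    then show ?case
      using S[OF u step(1)] step(2) by (simp add: gs.span_add gs.span_scale)
  qed (simp add: gs.span_zero)
  show ?thesis
    using f
  proof (induction rule: gs.span_induct_alt)
    case (step c x y)
    then show ?case
      using *[OF step(1)] by (simp add: distrib_right mult.assoc gs.span_add gs.span_scale)
  qed (simp add: gs.span_zero)
qed

definition mono_eval :: "('r \<Rightarrow>\<^sub>0 nat) \<Rightarrow> 'r::comm_ring_1" where
  "mono_eval m = (\<Prod>x\<in>Poly_Mapping.keys m. x ^ Poly_Mapping.lookup m x)"

lemma mono_eval_superset:
  assumes "finite F" "Poly_Mapping.keys m \<subseteq> F"
  shows "mono_eval m = (\<Prod>x\<in>F. x ^ Poly_Mapping.lookup m x)"
  unfolding mono_eval_def using assms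
  by (intro prod.mono_neutral_left) (auto simp: in_keys_iff)

lemma mono_eval_add: "mono_eval (m + n) = mono_eval m * mono_eval n"
proof -
  let ?F = "Poly_Mapping.keys m \<union> Poly_Mapping.keys n"
  have "Poly_Mapping.keys (m + n) \<subseteq> ?F"
    by (simp add: keys_add_nat)
  then show ?thesis
    by (simp add: mono_eval_superset[of ?F] lookup_add power_add prod.distrib)
qed

lemma mono_eval_0 [simp]: "mono_eval 0 = 1"
  by (simp add: mono_eval_def)

lemma mono_eval_single [simp]: "mono_eval (Poly_Mapping.single x (Suc 0)) = x"
  by (simp add: mono_eval_def)

lemma poly_eval_superset:
  assumes "finite S" "Poly_Mapping.keys P \<subseteq> S"
  shows "poly_eval const_gseries P =
    (\<Sum>m\<in>S. const_gseries (Poly_Mapping.lookup P m) * (mono_eval m :: ('u, 'k::field) gseries))"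
  unfolding poly_eval_def mono_eval_def using assms
  by (intro sum.mono_neutral_left) (auto simp: in_keys_iff)

lemma gen_alg_subset_poly_eval:
  fixes X :: "('u, 'k::field) gseries set"
  shows "gen_alg X \<subseteq> poly_eval const_gseries ` polys_in X"
proof
  define S where "S = {mono_eval m | m. Poly_Mapping.keys m \<subseteq> X}"
  fix f assume "f \<in> gen_alg X"
  then have "f \<in> gs.span S"
  proof induction
    case (const c)
    have "1 \<in> S"
      unfolding S_def by (intro CollectI exI[of _ 0]) simp
    then have "const_gseries c * 1 \<in> gs.span S"
      by (intro gs.span_scale gs.span_base)
    then show ?case by simp
  next
    case (gen x)
    then have "x \<in> S"
      unfolding S_def by (intro CollectI exI[of _ "Poly_Mapping.single x 1"]) simp
    then show ?case by (rule gs.span_base)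
  next
    case (mult f g)
    show ?case
    proof (rule span_mult_closed[OF _ mult.IH])
      fix u v assume "u \<in> S" "v \<in> S"
      then obtain m n where "u = mono_eval m" "v = mono_eval n"
        "Poly_Mapping.keys m \<subseteq> X" "Poly_Mapping.keys n \<subseteq> X"
        by (auto simp: S_def)
      then have "u * v \<in> S"
        unfolding S_def by (intro CollectI exI[of _ "m + n"]) (auto simp: mono_eval_add keys_add_nat)
      then show "u * v \<in> gs.span S" by (rule gs.span_base)
    qed
  qed (rule gs.span_add)
  then show "f \<in> poly_eval const_gseries ` polys_in X"
  proof (induction rule: gs.span_induct_alt)
    case base
    show ?case
      by (rule image_eqI[of _ _ 0]) (simp_all add: poly_eval_def polys_in_def)
  next
    case (step c x y)
    then obtain m Q where m: "x = mono_eval m" "Poly_Mapping.keys m \<subseteq> X"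
      and Q: "y = poly_eval const_gseries Q" "Q \<in> polys_in X"
      by (auto simp: S_def)
    let ?P = "Poly_Mapping.single m c + Q" and ?S = "insert m (Poly_Mapping.keys Q)"
    have keys: "Poly_Mapping.keys ?P \<subseteq> ?S"
      using Poly_Mapping.keys_add[of "Poly_Mapping.single m c" Q] by (auto split: if_splits)
    have "(\<Sum>n\<in>?S. const_gseries (Poly_Mapping.lookup (Poly_Mapping.single m c) n) * mono_eval n) =
        (\<Sum>n\<in>?S. if n = m then const_gseries c * (mono_eval m :: ('u, 'k) gseries) else 0)"
      by (intro sum.cong) (auto simp: lookup_single)
    then have "poly_eval const_gseries ?P = const_gseries c * x + y"
      using poly_eval_superset[of ?S ?P] poly_eval_superset[of ?S Q] keys
      by (simp add: lookup_add const_gseries_add distrib_right sum.distrib m Q subset_insertI)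
    moreover have "?P \<in> polys_in X"
      using keys m(2) Q(2) by (auto simp: polys_in_def)
    ultimately show ?case by (metis image_eqI)
  qed
qed

context hasse_subalgebra
begin

lemma algebraically_independent_minimal_generators:
  assumes X: "minimal_generators X"
  shows "algebraically_independent const_gseries X"
  unfolding algebraically_independent_def
proof (intro ballI impI)
  fix P assume P: "P \<in> polys_in X" and 0: "poly_eval const_gseries P = 0"
  let ?K = "Poly_Mapping.keys P"
  define F where "F = (\<Union>m\<in>?K. Poly_Mapping.keys m)"
  have F: "finite F" "F \<subseteq> X"
    using P by (auto simp: F_def polys_in_def)
  define a where "a \<beta> = Poly_Mapping.lookup P (Abs_poly_mapping \<beta>)" for \<beta>
  have "\<forall>\<beta>\<in>Poly_Mapping.lookup ` ?K. a \<beta> = 0"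
  proof (rule monomials_independent[OF X F])
    show "\<beta> x = 0" if "\<beta> \<in> Poly_Mapping.lookup ` ?K" "x \<notin> F" for \<beta> x
      using that by (auto simp: F_def in_keys_iff)
    have "(\<Sum>\<beta>\<in>Poly_Mapping.lookup ` ?K. const_gseries (a \<beta>) * (\<Prod>x\<in>F. x ^ \<beta> x)) =
        (\<Sum>m\<in>?K. const_gseries (Poly_Mapping.lookup P m) * mono_eval m)"
    proof (rule sum.reindex_cong)
      show "inj_on Poly_Mapping.lookup ?K"
        by (simp add: inj_on_def lookup_inject)
      fix m assume "m \<in> ?K"
      then have "mono_eval m = (\<Prod>x\<in>F. x ^ Poly_Mapping.lookup m x)"
        using F(1) by (intro mono_eval_superset) (auto simp: F_def)
      then show "const_gseries (a (Poly_Mapping.lookup m)) * (\<Prod>x\<in>F. x ^ Poly_Mapping.lookup m x) =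
          const_gseries (Poly_Mapping.lookup P m) * mono_eval m"
        by (simp add: a_def lookup_inverse)
    qed simp
    also have "\<dots> = poly_eval const_gseries P"
      by (simp add: poly_eval_def mono_eval_def)
    finally show "(\<Sum>\<beta>\<in>Poly_Mapping.lookup ` ?K. const_gseries (a \<beta>) * (\<Prod>x\<in>F. x ^ \<beta> x)) = 0"
      using 0 by simp
  qed simp
  then have "Poly_Mapping.lookup P m = 0" for m
    by (cases "m \<in> ?K") (simp_all add: a_def lookup_inverse in_keys_iff)
  then show "P = 0"
    by (intro poly_mapping_eqI) simp
qed

lemma poly_eval_minimal_generators:
  assumes X: "minimal_generators X"
  shows "R = poly_eval const_gseries ` polys_in X"
proof (rule equalityI)
  have "f \<in> gen_alg X" if "f \<in> R" for f
  proof -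
    obtain n where n: "f = (\<Sum>j\<le>n. hom_part j f)"
      using sum_hom_parts by blast
    have "hom_part j f \<in> gen_alg X" for j
    proof -
      have "hom_part j f \<in> gen_alg (below X (Suc j))"
        by (rule homogeneous_in_gen_alg[OF X hom_part_in[OF that] hom_part_in_homogeneous])
      moreover have "below X (Suc j) \<subseteq> X"
        by (auto simp: below_def)
      ultimately show ?thesis
        using gen_alg_mono by blast
    qed
    then show ?thesis
      by (subst n) (rule gen_alg_sum)
  qed
  then show "R \<subseteq> poly_eval const_gseries ` polys_in X"
    using gen_alg_subset_poly_eval by blast
  show "poly_eval const_gseries ` polys_in X \<subseteq> R"
  proof (rule image_subsetI)
    fix P :: "(('u, 'k) gseries \<Rightarrow>\<^sub>0 nat) \<Rightarrow>\<^sub>0 'k"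
    assume P: "P \<in> polys_in X"
    have "x \<in> R" if "x \<in> Poly_Mapping.keys m" "m \<in> Poly_Mapping.keys P" for x m
    proof -
      have "x \<in> X"
        using P that by (auto simp: polys_in_def)
      then show ?thesis
        using minimal_generatorsE[OF X] by blast
    qed
    then have "(\<Prod>x\<in>Poly_Mapping.keys m. x ^ Poly_Mapping.lookup m x) \<in> R" if "m \<in> Poly_Mapping.keys P" for m
      using that by (intro is_subring_prod[OF subring] is_subring_power[OF subring])
    then show "poly_eval const_gseries P \<in> R"
      unfolding poly_eval_def using subring const_in
      by (intro is_subring_sum[OF subring]) (simp add: is_subring_def)
  qed
qed

end

section \<open>The ring of bounded elements\<close>

text \<open>
  The coefficients of a Hasse derivative are integer multiples of coefficients of \<open>f\<close>, so the same
  denominator bounds them.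
\<close>

lemma hasse_in_gseries_flat:
  assumes A: "is_subring A" and f: "f \<in> gseries_flat A U"
  shows "hasse i k f \<in> gseries_flat A U"
proof -
  obtain b where b: "b \<in> A" "b \<noteq> 0" "\<And>e. b * gs_coeff f e \<in> A"
    using f by (auto simp: gseries_flat_def bounded_wrt_iff)
  have "b * gs_coeff (hasse i k f) e \<in> A" for e
  proof -
    have "of_nat n * (b * gs_coeff f u) \<in> A" for n u
      using A is_subring_of_nat[OF A] b(3) by (auto simp: is_subring_def)
    then show ?thesis
      unfolding hasse.rep_eq by (simp only: mult.left_commute[of b])
  qed
  moreover have "Poly_Mapping.keys e \<subseteq> U" if "gs_coeff (hasse i k f) e \<noteq> 0" for e
  proof -
    have "gs_coeff f (e + Poly_Mapping.single i k) \<noteq> 0"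
      using that by (auto simp: hasse.rep_eq)
    then have "Poly_Mapping.keys (e + Poly_Mapping.single i k) \<subseteq> U"
      using f by (simp add: gseries_flat_def gseries_over_def)
    then show ?thesis
      by (simp add: keys_add_nat)
  qed
  ultimately show ?thesis
    using b(1,2) by (auto simp: gseries_flat_def gseries_over_def bounded_wrt_iff)
qed

lemma hasse_subalgebra_gseries_flat:
  assumes A: "is_subring A" and K: "is_fraction_field_of A"
  shows "hasse_subalgebra (gseries_flat A U)"
proof
  show "is_subring (gseries_flat A U)"
    by (rule is_subring_gseries_flat[OF A])
  show "const_gseries c \<in> gseries_flat A U" for c
    by (rule const_gseries_in_flat[OF A K])
  show "hasse i k f \<in> gseries_flat A U" if "f \<in> gseries_flat A U" for i k f
    by (rule hasse_in_gseries_flat[OF A that])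
  show "hom_part n f \<in> gseries_flat A U" if "f \<in> gseries_flat A U" for n f
  proof -
    have "0 \<in> A"
      using A by (simp add: is_subring_def)
    then show ?thesis
      using that by (auto simp: gseries_flat_def gseries_over_def bounded_wrt_iff hom_part.rep_eq)
  qed
qed

theorem theorem6p2:
  fixes A :: "'k::field set" and U :: "'u set"
  assumes "is_subring A"
    and "is_fraction_field_of A"
    and "infinite U"
    and "CHAR('k) = 0 \<or> (CHAR('k) > 0 \<and> cond_C CHAR('k) |U| A)"
  shows "is_polynomial_algebra (const_gseries :: 'k \<Rightarrow> ('u, 'k) gseries)
           (gseries_flat A U) (\<lambda>d. gseries_flat A U \<inter> homogeneous d)"
proof -
  interpret hasse_subalgebra "gseries_flat A U"
    by (rule hasse_subalgebra_gseries_flat[OF assms(1,2)])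
  obtain X where X: "minimal_generators X"
    using minimal_generators_exist by blast
  then have "X \<subseteq> (\<Union>d\<in>{0<..}. gseries_flat A U \<inter> homogeneous d)"
    by (simp add: minimal_generators_def pos_elements_def)
  then show ?thesis
    unfolding is_polynomial_algebra_def
    using graded_algebra_gseries_flat[OF assms(1,2), of U] gseries_flat_degree_0[OF assms(1,2), of U]
      algebraically_independent_minimal_generators[OF X] poly_eval_minimal_generators[OF X]
    by blast
qed

end
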